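(* Let $d\geq 2$ and $k\geq 0$ be integers and let $p\geq 1$, $r>0$ be real numbers. (1) For $\varphi\in C^{\infty}_{\mathrm{rad}}(\overline{\mathbb{B}^{d}_{r}})$ let $f_{\varphi}\in C^{\infty}_{\mathrm{ev}}([0,r])$ and $\widetilde f_{\varphi}\in C^{\infty}([0,r^{2}])$ be the radial profiles of $\varphi$, i.e. the functions with $\varphi(x)=f_{\varphi}(|x|)=\widetilde f_{\varphi}(|x|^{2})$. Then the equivalence of norms $$\|\varphi\|_{W^{k,p}(\mathbb{B}^{d}_{r})}\simeq\sum_{j=0}^{k}\Big\|(\,\cdot\,)^{\frac{d-1}{p}+j}D^{j}f_{\varphi}\Big\|_{L^{p}(0,r)}\simeq\sum_{j=0}^{k}\Big\|(\,\cdot\,)^{\frac{d-2}{2p}+\frac{j}{2}}\widetilde f_{\varphi}^{(j)}\Big\|_{L^{p}(0,r^{2})}$$ holds for all $\varphi\in C^{\infty}_{\mathrm{rad}}(\overline{\mathbb{B}^{d}_{r}})$. (2) For $\varphi\in C^{\infty}_{\mathrm{rad}}(\mathbb{R}^{d})\cap C^{\infty}_{\mathrm{c}}(\mathbb{R}^{d})$ let $f_{\varphi}\in C^{\infty}_{\mathrm{ev}}([0,\infty))$ and $\widetilde f_{\varphi}\in C^{\infty}([0,\infty))$ be the radial profiles of $\varphi$, i.e. the functions with $\varphi(x)=f_{\varphi}(|x|)=\widetilde f_{\varphi}(|x|^{2})$. Then the equivalence of homogeneous Sobolev norms $$\|\varphi\|_{\dot W^{k,p}(\mathbb{R}^{d})}\simeq\Big\|(\,\cdot\,)^{\frac{d-1}{p}+k}D^{k}f_{\varphi}\Big\|_{L^{p}(0,\infty)}\simeq\Big\|(\,\cdot\,)^{\frac{d-2}{2p}+\frac{k}{2}}\widetilde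 f_{\varphi}^{(k)}\Big\|_{L^{p}(0,\infty)}$$ holds for all $\varphi\in C^{\infty}_{\mathrm{rad}}(\mathbb{R}^{d})\cap C^{\infty}_{\mathrm{c}}(\mathbb{R}^{d})$.
   Context: All functions are complex-valued. $\mathbb{B}^{d}_{r}=\{x\in\mathbb{R}^{d}: |x|<r\}$ is the open Euclidean ball. $C^{\infty}(\overline{\mathbb{B}^{d}_{r}})$ is the space of smooth functions on $\mathbb{B}^{d}_{r}$ whose derivatives of all orders are continuous up to the boundary; $C^{\infty}([0,r])$ is understood likewise. $C^{\infty}_{\mathrm{c}}(\mathbb{R}^{d})$ is the space of smooth functions with compact support. A function $\varphi$ on $\mathbb{B}^{d}_{r}$ or $\mathbb{R}^{d}$ ($d\ge 2$) is radially symmetric if $\varphi(Rx)=\varphi(x)$ for all $R\in SO(d)$ and all $x$; $C^{\infty}_{\mathrm{rad}}(\overline{\mathbb{B}^{d}_{r}})$ and $C^{\infty}_{\mathrm{rad}}(\mathbb{R}^{d})$ denote the radially symmetric functions in $C^{\infty}(\overline{\mathbb{B}^{d}_{r}})$ and $C^{\infty}(\mathbb{R}^{d})$. $C^{\infty}_{\mathrm{ev}}([0,r])=\{f\in C^{\infty}([0,r]): f^{(2n+1)}(0)=0 \text{ for all integers } n\ge 0\}$, and $C^{\infty}_{\mathrm{ev}}([0,\infty))$ is defined in the same way. It is a known fact that each $\varphi\in C^{\infty}_{\mathrm{rad}}(\overline{\mathbb{B}^{d}_{r}})$ can be written as $\varphi(x)=f_{\varphi}(|x|)=\widetilde f_{\varphi}(|x|^{2})$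 with (unique) $f_{\varphi}\in C^{\infty}_{\mathrm{ev}}([0,r])$ and $\widetilde f_{\varphi}\in C^{\infty}([0,r^{2}])$, and analogously on $\mathbb{R}^{d}$ with $[0,\infty)$ in place of $[0,r]$ and $[0,r^2]$. The operator $D$ acts on even smooth functions by $(Df)(\rho)=\rho^{-1}f'(\rho)$ for $\rho>0$, extended smoothly to $\rho=0$; it maps $C^{\infty}_{\mathrm{ev}}([0,r])$ to itself (and $C^{\infty}_{\mathrm{ev}}([0,\infty))$ to itself), and $D^{j}$ is its $j$-th iterate. $(\,\cdot\,)^{s}$ denotes the function $\rho\mapsto\rho^{s}$. Norms: $\|\varphi\|_{W^{k,p}(\mathbb{B}^{d}_{r})}=\big(\sum_{0\le|\alpha|\le k}\|\partial^{\alpha}\varphi\|_{L^{p}(\mathbb{B}^{d}_{r})}^{p}\big)^{1/p}$ and $\|\varphi\|_{\dot W^{k,p}(\mathbb{R}^{d})}=\big(\sum_{|\alpha|=k}\|\partial^{\alpha}\varphi\|_{L^{p}(\mathbb{R}^{d})}^{p}\big)^{1/p}$. $A(\varphi)\simeq B(\varphi)$ for all $\varphi$ in a class means that there are constants $c,C>0$, independent of $\varphi$ (but allowed to depend on $d,k,p$ and, in part (1), $r$), with $c\,B(\varphi)\le A(\varphi)\le C\,B(\varphi)$ for all $\varphi$ in the class. *)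

theory Defs
  imports "HOL-Analysis.Analysis"
begin

subsection \<open>Smooth functions of several variables\<close>

definition partial :: "'n \<Rightarrow> (real^'n \<Rightarrow> complex) \<Rightarrow> real^'n \<Rightarrow> complex" where
  "partial i \<phi> = (\<lambda>x. frechet_derivative \<phi> (at x) (axis i 1))"

text \<open>The partial derivatives belonging to a multi-index are taken in an arbitrary fixed order;
  for smooth functions the order does not matter.\<close>
definition mderiv :: "('n \<Rightarrow> nat) \<Rightarrow> (real^'n \<Rightarrow> complex) \<Rightarrow> real^'n \<Rightarrow> complex" where
  "mderiv \<alpha> = foldr partial (SOME is. \<forall>i. count_list is i = \<alpha> i)"

text \<open>Meant for open sets.\<close>
definition smooth_on_open :: "(real^'n) set \<Rightarrow> (real^'n \<Rightarrow> complex) \<Rightarrow> bool" where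
  "smooth_on_open U \<phi> \<longleftrightarrow> (\<forall>is. foldr partial is \<phi> differentiable_on U)"

text \<open>Members of the following space are functions on the open ball: their values elsewhere play
  no role.\<close>
definition Cinf_cball :: "real \<Rightarrow> (real^'n \<Rightarrow> complex) set" where
  "Cinf_cball r = {\<phi>. smooth_on_open (ball 0 r) \<phi> \<and>
     (\<forall>\<alpha>. \<exists>\<psi>. continuous_on (cball 0 r) \<psi> \<and> (\<forall>x\<in>ball 0 r. \<psi> x = mderiv \<alpha> \<phi> x))}"

definition radially_symmetric_on :: "(real^'n) set \<Rightarrow> (real^'n \<Rightarrow> complex) \<Rightarrow> bool" where
  "radially_symmetric_on U \<phi> \<longleftrightarrow>
     (\<forall>R::real^'n^'n. rotation_matrix R \<longrightarrow> (\<forall>x\<in>U. \<phi> (R *v x) = \<phi> x))"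

definition Cinf_rad_cball :: "real \<Rightarrow> (real^'n \<Rightarrow> complex) set" where
  "Cinf_rad_cball r = {\<phi>. \<phi> \<in> Cinf_cball r \<and> radially_symmetric_on (ball 0 r) \<phi>}"

definition Cinf_rad :: "(real^'n \<Rightarrow> complex) set" where
  "Cinf_rad = {\<phi>. smooth_on_open UNIV \<phi> \<and> radially_symmetric_on UNIV \<phi>}"

definition Cinf_c :: "(real^'n \<Rightarrow> complex) set" where
  "Cinf_c = {\<phi>. smooth_on_open UNIV \<phi> \<and> compact (closure {x. \<phi> x \<noteq> 0})}"

subsection \<open>Smooth functions on an interval\<close>

text \<open>In this subsection \<open>I\<close> is \<open>{0..a}\<close> or \<open>{0..}\<close>. Derivatives are taken relative to \<open>I\<close>, so
  they are one-sided at the end points and do not depend on values outside \<open>I\<close>.\<close>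

definition ideriv :: "real set \<Rightarrow> nat \<Rightarrow> (real \<Rightarrow> complex) \<Rightarrow> real \<Rightarrow> complex" where
  "ideriv I n f = ((\<lambda>g x. vector_derivative g (at x within I)) ^^ n) f"

definition Cinf_on :: "real set \<Rightarrow> (real \<Rightarrow> complex) set" where
  "Cinf_on I = {f. \<forall>n. ideriv I n f differentiable_on I}"

definition Cinf_ev :: "real set \<Rightarrow> (real \<Rightarrow> complex) set" where
  "Cinf_ev I = {f \<in> Cinf_on I. \<forall>n. ideriv I (2 * n + 1) f 0 = 0}"

text \<open>The value at the origin is the limit of the values at positive points, i.e. the one given
  by the smooth extension.\<close>
definition D_op :: "real set \<Rightarrow> (real \<Rightarrow> complex) \<Rightarrow> real \<Rightarrow> complex" where
  "D_op I f = (\<lambda>\<rho>. if \<rho> = 0 then Lim (at 0 within I) (\<lambda>s. ideriv I 1 f s /\<^sub>R s)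
                   else ideriv I 1 f \<rho> /\<^sub>R \<rho>)"

subsection \<open>Norms\<close>

text \<open>Norms take values in \<open>[0, \<infinity>]\<close>, so that no integrability has to be presupposed. The exponent
  of the following power is always positive.\<close>
definition epowr :: "ennreal \<Rightarrow> real \<Rightarrow> ennreal" where
  "epowr x a = (if x = \<infinity> then \<infinity> else ennreal (enn2real x powr a))"

definition Lp_norm :: "real \<Rightarrow> 'a::euclidean_space set \<Rightarrow> ('a \<Rightarrow> complex) \<Rightarrow> ennreal" where
  "Lp_norm p A f = epowr (\<integral>\<^sup>+x\<in>A. ennreal (norm (f x) powr p) \<partial>lborel) (1 / p)"

definition W_norm :: "nat \<Rightarrow> real \<Rightarrow> (real^'n) set \<Rightarrow> (real^'n \<Rightarrow> complex) \<Rightarrow> ennreal" where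
  "W_norm k p U \<phi> =
     epowr (\<Sum>\<alpha> | (\<Sum>i\<in>UNIV. \<alpha> i) \<le> k. epowr (Lp_norm p U (mderiv \<alpha> \<phi>)) p) (1 / p)"

definition W_hom_norm :: "nat \<Rightarrow> real \<Rightarrow> (real^'n \<Rightarrow> complex) \<Rightarrow> ennreal" where
  "W_hom_norm k p \<phi> =
     epowr (\<Sum>\<alpha> | (\<Sum>i\<in>UNIV. \<alpha> i) = k. epowr (Lp_norm p UNIV (mderiv \<alpha> \<phi>)) p) (1 / p)"

definition equivalent_on :: "'a set \<Rightarrow> ('a \<Rightarrow> ennreal) \<Rightarrow> ('a \<Rightarrow> ennreal) \<Rightarrow> bool" where
  "equivalent_on X A B \<longleftrightarrow> (\<exists>c C::real. 0 < c \<and> 0 < C \<and>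
     (\<forall>x\<in>X. ennreal c * B x \<le> A x \<and> A x \<le> ennreal C * B x))"

subsection \<open>Radial functions together with their profiles\<close>

text \<open>The profiles are determined by \<open>\<phi>\<close> only on the intervals on which they live; the triples
  below allow arbitrary values outside, which enter none of the norms.\<close>

definition radial_profiles_ball ::
    "real \<Rightarrow> ((real^'n \<Rightarrow> complex) \<times> (real \<Rightarrow> complex) \<times> (real \<Rightarrow> complex)) set" where
  "radial_profiles_ball r = {(\<phi>, f, g). \<phi> \<in> Cinf_rad_cball r \<and>
     f \<in> Cinf_ev {0..r} \<and> g \<in> Cinf_on {0..r\<^sup>2} \<and>
     (\<forall>x\<in>ball 0 r. \<phi> x = f (norm x) \<and> \<phi> x = g ((norm x)\<^sup>2))}"

definition radial_profiles_space ::
    "((real^'n \<Rightarrow> complex) \<times> (real \<Rightarrow> complex) \<times> (real \<Rightarrow> complex)) set" where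
  "radial_profiles_space = {(\<phi>, f, g). \<phi> \<in> Cinf_rad \<inter> Cinf_c \<and>
     f \<in> Cinf_ev {0..} \<and> g \<in> Cinf_on {0..} \<and>
     (\<forall>x. \<phi> x = f (norm x) \<and> \<phi> x = g ((norm x)\<^sup>2))}"

end

theory Submission
  imports Defs
begin

text \<open>
  Put \<open>\<phi> x = g (|x|\<^sup>2)\<close>. Every partial derivative of order \<open>m\<close> of such a function is a sum of terms
  \<open>P x * g\<^sup>(\<^sup>j\<^sup>) (|x|\<^sup>2)\<close> with \<open>m / 2 \<le> j \<le> m\<close>, where \<open>P\<close> is a homogeneous polynomial of degree
  \<open>2 * j - m\<close> that does not depend on \<open>\<phi>\<close>. As \<open>f \<rho> = g (\<rho>\<^sup>2)\<close>, the operator \<open>D\<close> corresponds to twice the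
  derivative of \<open>g\<close>, so \<open>D\<^sup>j f\<close> at \<open>\<rho>\<close> is \<open>2 ^ j\<close> times \<open>g\<^sup>(\<^sup>j\<^sup>)\<close> at \<open>\<rho>\<^sup>2\<close>. Integration of radial
  functions therefore turns the \<open>p\<close>-th powers of all norms in the theorem into the weighted integrals
  \<open>radial_energy\<close> of the functions \<open>s\<^sup>w * |g\<^sup>(\<^sup>j\<^sup>) s|\<close> for the measure \<open>s\<^sup>d\<^sup>/\<^sup>2\<^sup>-\<^sup>1 ds\<close>. The norms
  of the two profiles agree term by term up to explicit factors, by the substitution \<open>s = \<rho>\<^sup>2\<close>.

  The Sobolev norm controls the energies pointwise. For \<open>a \<noteq> b\<close> the vector \<open>e\<^sub>a + \<i> * e\<^sub>b\<close> is isotropic for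
  the complex bilinear extension of the inner product, hence
  \<open>(\<partial>\<^sub>a + \<i> * \<partial>\<^sub>b)\<^sup>k \<phi> x = 2 ^ k * (x\<^sub>a + \<i> * x\<^sub>b) ^ k * g\<^sup>(\<^sup>k\<^sup>) (|x|\<^sup>2)\<close>: no lower derivative of \<open>g\<close>
  survives (\<open>sum_words_foldr_partial\<close>). If \<open>a\<close> belongs to the largest coordinate of \<open>x\<close>, then
  \<open>|x\<^sub>a + \<i> * x\<^sub>b|\<close> is comparable to \<open>|x|\<close> (\<open>radial_derivative_bound\<close>). A second coordinate direction is
  what \<open>d \<ge> 2\<close> provides.

  In the other direction the terms above have the weights \<open>s\<^sup>j\<^sup>-\<^sup>m\<^sup>/\<^sup>2\<close>, which for \<open>j < m\<close> are more singular
  at the origin than the weight \<open>s\<^sup>m\<^sup>/\<^sup>2\<close>, and no pointwise bound is possible. Hardy's inequality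
  (\<open>Hardy_inequality\<close>) trades one power of \<open>s\<close> for one derivative, and \<open>m - j\<close> applications lead to the
  order \<open>m\<close> with weight \<open>s\<^sup>m\<^sup>/\<^sup>2\<close>. For compactly supported functions on the half-line this is the
  whole estimate. On a bounded interval the missing boundary condition is enforced by a cut-off, which
  brings in the functions of lower order with the same weight \<open>s\<^sup>m\<^sup>/\<^sup>2\<close>; there \<open>s\<^sup>m\<^sup>/\<^sup>2\<close> is bounded
  by a constant times \<open>s\<^sup>i\<^sup>/\<^sup>2\<close> for \<open>i \<le> m\<close>.

  The origin is a null set. All identities are used on the punctured ball only, where \<open>|x|\<^sup>2\<close> is an
  interior point of the interval on which \<open>g\<close> is smooth.
\<close>

section \<open>Estimates up to constants\<close>

text \<open>
  Inequality up to a constant that is uniform on \<open>X\<close>. It is a preorder compatible with finite sums and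
  with powers, which keeps the constants of the individual estimates out of sight.
\<close>

definition dominated_on :: "'a set \<Rightarrow> ('a \<Rightarrow> ennreal) \<Rightarrow> ('a \<Rightarrow> ennreal) \<Rightarrow> bool" where
  "dominated_on X A B \<longleftrightarrow> (\<exists>C::real. 0 < C \<and> (\<forall>x\<in>X. A x \<le> ennreal C * B x))"

lemma dominated_onI:
  assumes "0 \<le> C" "\<And>x. x \<in> X \<Longrightarrow> A x \<le> ennreal C * B x"
  shows "dominated_on X A B"
  \<comment> \<open>\<open>C\<close> may be zero, while the definition asks for a positive constant.\<close>
  unfolding dominated_on_def
proof (intro exI[of _ "C + 1"] conjI ballI)
  fix x assume "x \<in> X"
  then have "A x \<le> ennreal C * B x" by (rule assms)
  also have "\<dots> \<le> ennreal (C + 1) * B x"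
    by (intro mult_right_mono ennreal_leI) auto
  finally show "A x \<le> ennreal (C + 1) * B x" .
qed (use assms in auto)

lemma dominated_on_mono: "(\<And>x. x \<in> X \<Longrightarrow> A x \<le> B x) \<Longrightarrow> dominated_on X A B"
  by (rule dominated_onI[of 1]) auto

lemma dominated_on_trans [trans]:
  assumes "dominated_on X A B" "dominated_on X B C"
  shows "dominated_on X A C"
proof -
  obtain c where c: "0 < c" "\<And>x. x \<in> X \<Longrightarrow> A x \<le> ennreal c * B x"
    using assms(1) unfolding dominated_on_def by blast
  obtain c' where c': "0 < c'" "\<And>x. x \<in> X \<Longrightarrow> B x \<le> ennreal c' * C x"
    using assms(2) unfolding dominated_on_def by blast
  show ?thesis
  proof (rule dominated_onI[of "c * c'"])
    fix x assume x: "x \<in> X"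
    have "A x \<le> ennreal c * B x" by (rule c(2)[OF x])
    also have "\<dots> \<le> ennreal c * (ennreal c' * C x)" by (intro mult_left_mono c'(2) x) auto
    finally show "A x \<le> ennreal (c * c') * C x"
      using c c' by (simp add: ennreal_mult mult.assoc)
  qed (use c c' in auto)
qed

lemma dominated_on_sum:
  assumes "finite I" "\<And>i. i \<in> I \<Longrightarrow> dominated_on X (A i) B"
  shows "dominated_on X (\<lambda>x. \<Sum>i\<in>I. A i x) B"
proof -
  obtain c where c: "\<And>i. i \<in> I \<Longrightarrow> 0 < c i"
    "\<And>i x. i \<in> I \<Longrightarrow> x \<in> X \<Longrightarrow> A i x \<le> ennreal (c i) * B x"
    using assms(2) unfolding dominated_on_def by metis
  show ?thesis
  proof (rule dominated_onI[of "\<Sum>i\<in>I. c i"])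
    fix x assume x: "x \<in> X"
    have "(\<Sum>i\<in>I. A i x) \<le> (\<Sum>i\<in>I. ennreal (c i) * B x)"
      by (intro sum_mono c x)
    also have "\<dots> = ennreal (\<Sum>i\<in>I. c i) * B x"
      using c(1) by (simp add: sum_distrib_right[symmetric] sum_ennreal less_imp_le)
    finally show "(\<Sum>i\<in>I. A i x) \<le> ennreal (\<Sum>i\<in>I. c i) * B x" .
  qed (auto intro!: sum_nonneg less_imp_le[OF c(1)])
qed

lemma dominated_on_member:
  assumes "finite I" "i \<in> I"
  shows "dominated_on X (A i) (\<lambda>x. \<Sum>i\<in>I. A i x)"
  by (rule dominated_on_mono) (rule member_le_sum, use assms in auto)

lemma equivalent_onI:
  assumes "dominated_on X A B" "dominated_on X B A"
  shows "equivalent_on X A B"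
proof -
  obtain C where C: "0 < C" "\<And>x. x \<in> X \<Longrightarrow> A x \<le> ennreal C * B x"
    using assms(1) unfolding dominated_on_def by blast
  obtain c where c: "0 < c" "\<And>x. x \<in> X \<Longrightarrow> B x \<le> ennreal c * A x"
    using assms(2) unfolding dominated_on_def by blast
  have "ennreal (1/c) * B x \<le> A x" if "x \<in> X" for x
  proof -
    have "ennreal (1/c) * B x \<le> ennreal (1/c) * (ennreal c * A x)"
      by (intro mult_left_mono c that) auto
    also have "\<dots> = A x"
      using c(1) by (simp add: mult.assoc[symmetric] ennreal_mult[symmetric])
    finally show ?thesis .
  qed
  then show ?thesis unfolding equivalent_on_def
    using C c(1) by (intro exI[of _ "1/c"] exI[of _ C]) auto
qed

lemma epowr_mono: "0 \<le> a \<Longrightarrow> x \<le> y \<Longrightarrow> epowr x a \<le> epowr y a"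
  by (auto simp: epowr_def top_unique enn2real_mono less_top intro!: ennreal_leI powr_mono2)

lemma epowr_cmult: "0 < c \<Longrightarrow> epowr (ennreal c * x) a = ennreal (c powr a) * epowr x a"
  by (cases x) (auto simp: epowr_def ennreal_mult_eq_top_iff powr_mult ennreal_mult[symmetric]
     ennreal_mult_top)

lemma epowr_epowr: "a * b = 1 \<Longrightarrow> epowr (epowr x a) b = x"
  by (cases x) (auto simp: epowr_def powr_powr)

lemma dominated_on_epowr:
  assumes "0 \<le> a" "dominated_on X A B"
  shows "dominated_on X (\<lambda>x. epowr (A x) a) (\<lambda>x. epowr (B x) a)"
proof -
  obtain c where c: "0 < c" "\<And>x. x \<in> X \<Longrightarrow> A x \<le> ennreal c * B x"
    using assms(2) unfolding dominated_on_def by blast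
  show ?thesis
    by (rule dominated_onI[of "c powr a"])
       (use c epowr_mono[OF assms(1) c(2)] in \<open>auto simp: epowr_cmult\<close>)
qed

lemma dominated_on_sum_epowr:
  assumes "finite I" "0 < a"
  shows "dominated_on X (\<lambda>x. \<Sum>i\<in>I. epowr (A i x) a) (\<lambda>x. epowr (\<Sum>i\<in>I. A i x) a)"
  using assms
  by (intro dominated_on_sum dominated_on_epowr dominated_on_member) auto

text \<open>
  With \<open>dominated_on_sum_epowr\<close> this says that, up to constants, a finite \<open>\<ell>\<^sup>p\<close> sum of norms is the
  same as their \<open>\<ell>\<^sup>1\<close> sum; here \<open>a = 1 / p\<close> and the \<open>A i\<close> are \<open>p\<close>-th powers of norms.
\<close>

lemma dominated_on_epowr_sum:
  assumes "finite I" "0 < a"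
  shows "dominated_on X (\<lambda>x. epowr (\<Sum>i\<in>I. A i x) a) (\<lambda>x. \<Sum>i\<in>I. epowr (A i x) a)"
proof -
  have "dominated_on X (\<lambda>x. \<Sum>i\<in>I. epowr (epowr (A i x) a) (1/a))
      (\<lambda>x. epowr (\<Sum>i\<in>I. epowr (A i x) a) (1/a))"
    using assms by (intro dominated_on_sum_epowr) auto
  then have "dominated_on X (\<lambda>x. \<Sum>i\<in>I. A i x) (\<lambda>x. epowr (\<Sum>i\<in>I. epowr (A i x) a) (1/a))"
    using assms by (simp add: epowr_epowr)
  from dominated_on_epowr[OF _ this, of a] show ?thesis
    using assms by (simp add: epowr_epowr)
qed

lemma powr_sum_le:
  fixes y :: "'i \<Rightarrow> real"
  assumes "finite I" "0 \<le> p" "\<And>i. i \<in> I \<Longrightarrow> 0 \<le> y i"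
  shows "(\<Sum>i\<in>I. y i) powr p \<le> real (card I) powr p * (\<Sum>i\<in>I. y i powr p)"
proof (cases "I = {}")
  case False
  have "Max (y ` I) \<in> y ` I" using assms False by (intro Max_in) auto
  then obtain m where m: "m \<in> I" "Max (y ` I) = y m" by blast
  have "y i \<le> y m" if "i \<in> I" for i
    using Max_ge[of "y ` I" "y i"] assms(1) that by (simp add: m(2))
  then have "(\<Sum>i\<in>I. y i) \<le> real (card I) * y m"
    by (rule sum_bounded_above)
  then have "(\<Sum>i\<in>I. y i) powr p \<le> (real (card I) * y m) powr p"
    using assms by (intro powr_mono2 sum_nonneg) auto
  also have "\<dots> = real (card I) powr p * y m powr p"
    using assms m by (simp add: powr_mult)
  also have "\<dots> \<le> real (card I) powr p * (\<Sum>i\<in>I. y i powr p)"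
    using assms m by (intro mult_left_mono member_le_sum) auto
  finally show ?thesis .
qed simp

lemma powr_add_le:
  fixes x y :: real
  assumes "0 \<le> p" "0 \<le> x" "0 \<le> y"
  shows "(x + y) powr p \<le> 2 powr p * (x powr p + y powr p)"
  using powr_sum_le[of "{True, False}" p "\<lambda>b. if b then x else y"] assms by simp

section \<open>Integration of radial functions\<close>

lemma nn_integral_powr_Ioo_0:
  fixes a c :: real
  assumes "-1 < a" "0 \<le> c"
  shows "(\<integral>\<^sup>+t\<in>{0<..<c}. ennreal (t powr a) \<partial>lborel) = ennreal (c powr (a + 1) / (a + 1))"
proof -
  have "(\<integral>\<^sup>+t\<in>{0<..<c}. ennreal (t powr a) \<partial>lborel) = (\<integral>\<^sup>+t\<in>{0..c}. ennreal (t powr a) \<partial>lborel)"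
  proof (rule nn_integral_cong_AE)
    show "AE t in lborel. ennreal (t powr a) * indicator {0<..<c} t = ennreal (t powr a) * indicator {0..c} t"
      using AE_lborel_singleton[of 0] AE_lborel_singleton[of c]
      by eventually_elim (auto simp: indicator_def)
  qed
  also have "\<dots> = ennreal (c powr (a + 1) / (a + 1))"
    by (rule nn_integral_has_integral_lebesgue'[OF _ has_integral_powr_from_0[OF assms]]) auto
  finally show ?thesis .
qed

lemma nn_integral_powr_Ioi:
  fixes e s :: real
  assumes "e < -1" "0 < s"
  shows "(\<integral>\<^sup>+t\<in>{s<..}. ennreal (t powr e) \<partial>lborel) = ennreal (- (s powr (e + 1)) / (e + 1))"
proof -
  have "(\<integral>\<^sup>+t\<in>{s<..}. ennreal (t powr e) \<partial>lborel) = (\<integral>\<^sup>+t\<in>{s..}. ennreal (t powr e) \<partial>lborel)"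
  proof (rule nn_integral_cong_AE)
    show "AE t in lborel. ennreal (t powr e) * indicator {s<..} t = ennreal (t powr e) * indicator {s..} t"
      using AE_lborel_singleton[of s]
      by eventually_elim (auto simp: indicator_def)
  qed
  also have "\<dots> = ennreal (- (s powr (e + 1)) / (e + 1))"
    by (rule nn_integral_has_integral_lebesgue'[OF _ has_integral_powr_to_inf[OF assms]]) auto
  finally show ?thesis .
qed

text \<open>
  The hypothesis determines the image measure of \<open>M\<close> under \<open>T\<close> on the half-lines \<open>{..a}\<close>, which form an
  intersection-stable generator; the density on the right is the derivative of \<open>C * a powr b\<close>.
\<close>

lemma nn_integral_compose_powr_layers:
  fixes T :: "'a \<Rightarrow> real" and C b :: real and H :: "real \<Rightarrow> ennreal"
  assumes T: "T \<in> borel_measurable M" "\<And>x. x \<in> space M \<Longrightarrow> 0 \<le> T x"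
    and layers: "\<And>a. 0 \<le> a \<Longrightarrow> emeasure M {x \<in> space M. T x \<le> a} = ennreal (C * a powr b)"
    and C: "0 \<le> C" and b: "0 < b" and H: "H \<in> borel_measurable borel"
  shows "(\<integral>\<^sup>+x. H (T x) \<partial>M) = ennreal (C * b) * (\<integral>\<^sup>+s\<in>{0<..}. ennreal (s powr (b - 1)) * H s \<partial>lborel)"
proof -
  define h where "h = (\<lambda>s. ennreal (C * b * s powr (b - 1)) * indicator {0<..} s)"
  have h: "h \<in> borel_measurable lborel" unfolding h_def by measurable
  have pos: "emeasure (distr M borel T) {..a} = ennreal (C * a powr b)" if "0 \<le> a" for a
    using T(1) layers[OF that] by (simp add: emeasure_distr vimage_def Int_def conj_commute)
  have pos': "emeasure (density lborel h) {..a} = ennreal (C * a powr b)" if "0 \<le> a" for a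
  proof -
    have "emeasure (density lborel h) {..a} = (\<integral>\<^sup>+s. h s * indicator {..a} s \<partial>lborel)"
      using h by (simp add: emeasure_density)
    also have "\<dots> = (\<integral>\<^sup>+s. ennreal (C * b) * (ennreal (s powr (b - 1)) * indicator {0<..<a} s) \<partial>lborel)"
    proof (rule nn_integral_cong_AE)
      show "AE s in lborel. h s * indicator {..a} s = ennreal (C * b) * (ennreal (s powr (b - 1)) * indicator {0<..<a} s)"
        using AE_lborel_singleton[of a]
        by eventually_elim (use C b in \<open>auto simp: h_def indicator_def ennreal_mult\<close>)
    qed
    also have "\<dots> = ennreal (C * b) * ennreal (a powr b / b)"
      using that b by (simp add: nn_integral_cmult nn_integral_powr_Ioo_0)
    also have "\<dots> = ennreal (C * a powr b)"
      using C b by (simp add: ennreal_mult[symmetric])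
    finally show ?thesis .
  qed
  have neg: "emeasure (distr M borel T) {..a} = 0" if "a < 0" for a
  proof -
    have "T -` {..a} \<inter> space M = {}" using T(2) that by force
    then show ?thesis using T(1) by (simp add: emeasure_distr)
  qed
  have neg': "emeasure (density lborel h) {..a} = 0" if "a < 0" for a
  proof -
    have "emeasure (density lborel h) {..a} = (\<integral>\<^sup>+s. h s * indicator {..a} s \<partial>lborel)"
      using h by (simp add: emeasure_density)
    also have "\<dots> = (\<integral>\<^sup>+s. 0 \<partial>(lborel::real measure))"
      by (rule nn_integral_cong) (use that in \<open>auto simp: h_def indicator_def\<close>)
    finally show ?thesis by simp
  qed
  have eq: "distr M borel T = density lborel h"
  proof (rule measure_eqI_generator_eq[where E = "range (\<lambda>a::real. {..a})" and \<Omega> = UNIV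
        and A = "\<lambda>n::nat. {..real n}"])
    show "Int_stable (range (\<lambda>a::real. {..a}))"
      by (auto simp: Int_stable_def)
    show "sets (distr M borel T) = sigma_sets UNIV (range (\<lambda>a::real. {..a}))"
      "sets (density lborel h) = sigma_sets UNIV (range (\<lambda>a::real. {..a}))"
      unfolding sets_distr sets_density sets_lborel by (simp_all add: borel_eq_atMost)
    show "emeasure (distr M borel T) X = emeasure (density lborel h) X"
      if "X \<in> range (\<lambda>a::real. {..a})" for X
    proof -
      from that obtain a where X: "X = {..a}" by auto
      show ?thesis unfolding X by (cases "a < 0") (simp_all add: pos pos' neg neg')
    qed
    show "(\<Union>n::nat. {..real n}) = UNIV"
      by (auto intro: real_arch_simple)
    show "emeasure (distr M borel T) {..real n} \<noteq> \<infinity>" for n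
      by (simp add: pos)
  qed auto
  have "(\<integral>\<^sup>+x. H (T x) \<partial>M) = (\<integral>\<^sup>+s. H s \<partial>distr M borel T)"
    using T(1) H by (simp add: nn_integral_distr)
  also have "\<dots> = (\<integral>\<^sup>+s. h s * H s \<partial>lborel)"
    unfolding eq using H h by (simp add: nn_integral_density)
  also have "\<dots> = (\<integral>\<^sup>+s. ennreal (C * b) * (ennreal (s powr (b - 1)) * H s * indicator {0<..} s) \<partial>lborel)"
    by (rule nn_integral_cong) (use C b in \<open>auto simp: h_def indicator_def ennreal_mult mult_ac\<close>)
  also have "\<dots> = ennreal (C * b) * (\<integral>\<^sup>+s\<in>{0<..}. ennreal (s powr (b - 1)) * H s \<partial>lborel)"
    using H by (subst nn_integral_cmult) auto
  finally show ?thesis .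
qed

text \<open>
  Polar coordinates for radial functions, from the volumes of balls. The case \<open>n = 1\<close>
  serves the profile in \<open>|x|\<close>, and \<open>n = 2\<close> the one in \<open>|x|\<^sup>2\<close>.
\<close>

lemma nn_integral_radial:
  fixes H :: "real \<Rightarrow> ennreal"
  assumes H: "H \<in> borel_measurable borel" and n: "0 < n"
  defines "d \<equiv> DIM('a::euclidean_space)"
  shows "(\<integral>\<^sup>+x. H (norm (x::'a) ^ n) \<partial>lborel)
    = ennreal (unit_ball_vol d * (d / n)) * (\<integral>\<^sup>+s\<in>{0<..}. ennreal (s powr (d / n - 1)) * H s \<partial>lborel)"
proof (rule nn_integral_compose_powr_layers[OF _ _ _ _ _ H])
  fix a :: real assume a: "0 \<le> a"
  have "{x \<in> space lborel. norm (x::'a) ^ n \<le> a} = cball 0 (root n a)"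
  proof (intro set_eqI)
    fix x :: 'a
    have "norm x ^ n \<le> a \<longleftrightarrow> norm x ^ n \<le> root n a ^ n"
      using a n by simp
    also have "\<dots> \<longleftrightarrow> norm x \<le> root n a"
      using a n by (subst power_mono_iff) auto
    finally show "x \<in> {x \<in> space lborel. norm x ^ n \<le> a} \<longleftrightarrow> x \<in> cball 0 (root n a)" by simp
  qed
  moreover have "root n a ^ d = a powr (d / n)"
  proof (cases "a = 0")
    case True
    then show ?thesis using n by (simp add: d_def)
  next
    case False
    then show ?thesis using a n
      by (simp add: root_powr_inverse powr_realpow[symmetric] powr_powr)
  qed
  ultimately show "emeasure lborel {x \<in> space lborel. norm (x::'a) ^ n \<le> a} = ennreal (unit_ball_vol d * a powr (d / n))"
    using a n by (simp add: emeasure_cball d_def)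
next
  show "0 < real d / real n" using n by (simp add: d_def)
qed (auto)

section \<open>Hardy's inequality\<close>

text \<open>
  The tangent to the convex function \<open>x powr p\<close> at \<open>c\<close>, evaluated at \<open>x = v / K\<close> and multiplied by \<open>K\<close>.
\<close>

lemma weighted_Young_powr:
  fixes p v c K :: real
  assumes p: "1 \<le> p" and v: "0 \<le> v" and c: "0 < c" and K: "0 < K"
  shows "p * c powr (p - 1) * v \<le> v powr p * K powr (1 - p) + (p - 1) * c powr p * K"
proof (cases "v = 0")
  case True
  then show ?thesis using p K by simp
next
  case False
  define x where "x = v / K"
  have x: "0 < x" using v K False by (simp add: x_def)
  have "(x powr p) powr (1 / p) * (c powr p) powr (1 - 1 / p) \<le> (1 / p) * x powr p + (1 - 1 / p) * c powr p"
    using p x c by (intro Youngs_inequality_0) auto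
  moreover have "(x powr p) powr (1 / p) = x" using p x by (simp add: powr_powr)
  moreover have "(c powr p) powr (1 - 1 / p) = c powr (p - 1)"
  proof -
    have "p * (1 - 1 / p) = p - 1" using p by (simp add: algebra_simps)
    then show ?thesis by (simp add: powr_powr)
  qed
  ultimately have "p * (x * c powr (p - 1)) \<le> p * ((1 / p) * x powr p + (1 - 1 / p) * c powr p)"
    using p by (intro mult_left_mono) auto
  also have "\<dots> = x powr p + (p - 1) * c powr p" using p by (simp add: field_simps)
  finally have "(p * (x * c powr (p - 1))) * K \<le> (x powr p + (p - 1) * c powr p) * K"
    using K by (intro mult_right_mono) auto
  moreover have "x powr p * K = v powr p * K powr (1 - p)"
    using K v by (simp add: x_def powr_divide powr_diff)
  moreover have "v = x * K" using K by (simp add: x_def)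
  ultimately show ?thesis by (simp add: algebra_simps)
qed

text \<open>
  Jensen's inequality for the probability density \<open>K t = \<delta> * s powr \<delta> * t powr (- 1 - \<delta>)\<close> on \<open>{s<..}\<close>,
  obtained by integrating \<open>weighted_Young_powr\<close> with \<open>c = w\<close>. Using the tangent at \<open>w\<close> rather than at
  the integral of \<open>v\<close> makes it valid even if that integral is infinite.
\<close>

lemma powr_le_weighted_integral:
  fixes p \<delta> s w :: real and v :: "real \<Rightarrow> real"
  assumes p: "1 \<le> p" and \<delta>: "0 < \<delta>" and s: "0 < s"
    and v [measurable]: "v \<in> borel_measurable borel" "\<And>t. 0 \<le> v t"
    and w: "0 \<le> w" "ennreal w \<le> (\<integral>\<^sup>+t\<in>{s<..}. ennreal (v t) \<partial>lborel)"
  shows "ennreal (w powr p) \<le>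
    (\<integral>\<^sup>+t\<in>{s<..}. ennreal (v t powr p * (\<delta> * s powr \<delta> * t powr (- 1 - \<delta>)) powr (1 - p)) \<partial>lborel)"
    (is "_ \<le> ?V")
proof (cases "w = 0")
  case True
  then show ?thesis by simp
next
  case False
  define K where "K t = \<delta> * s powr \<delta> * t powr (- 1 - \<delta>)" for t
  have K [measurable]: "K \<in> borel_measurable borel" unfolding K_def by measurable
  have K0: "0 < K t" if "s < t" for t using \<delta> s that by (simp add: K_def)
  \<comment> \<open>\<open>K\<close> is a probability density on \<open>{s<..}\<close>.\<close>
  have K1: "(\<integral>\<^sup>+t\<in>{s<..}. ennreal (K t) \<partial>lborel) = 1"
  proof -
    have "(\<integral>\<^sup>+t\<in>{s<..}. ennreal (K t) \<partial>lborel) =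
      (\<integral>\<^sup>+t. ennreal (\<delta> * s powr \<delta>) * (ennreal (t powr (- 1 - \<delta>)) * indicator {s<..} t) \<partial>lborel)"
      using \<delta> by (intro nn_integral_cong) (auto simp: K_def ennreal_mult mult_ac)
    also have "\<dots> = ennreal (\<delta> * s powr \<delta>) * ennreal (s powr (- \<delta>) / \<delta>)"
      using \<delta> s by (simp add: nn_integral_cmult nn_integral_powr_Ioi)
    also have "\<dots> = 1"
      using \<delta> s by (simp add: ennreal_mult[symmetric] powr_minus)
    finally show ?thesis .
  qed
  have "ennreal (p * w powr p) = ennreal (p * w powr (p - 1)) * ennreal w"
    using p w False by (simp add: ennreal_mult[symmetric] powr_diff)
  also have "\<dots> \<le> ennreal (p * w powr (p - 1)) * (\<integral>\<^sup>+t\<in>{s<..}. ennreal (v t) \<partial>lborel)"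
    by (intro mult_left_mono w) auto
  also have "\<dots> = (\<integral>\<^sup>+t. ennreal (p * w powr (p - 1)) * (ennreal (v t) * indicator {s<..} t) \<partial>lborel)"
    by (rule nn_integral_cmult[symmetric]) measurable
  also have "\<dots> \<le> (\<integral>\<^sup>+t. ennreal (v t powr p * K t powr (1 - p)) * indicator {s<..} t
      + ennreal ((p - 1) * w powr p) * (ennreal (K t) * indicator {s<..} t) \<partial>lborel)"
  proof (rule nn_integral_mono)
    fix t :: real
    show "ennreal (p * w powr (p - 1)) * (ennreal (v t) * indicator {s<..} t)
      \<le> ennreal (v t powr p * K t powr (1 - p)) * indicator {s<..} t
      + ennreal ((p - 1) * w powr p) * (ennreal (K t) * indicator {s<..} t)"
    proof (cases "s < t")
      case True
      have "ennreal (p * w powr (p - 1)) * ennreal (v t) = ennreal (p * w powr (p - 1) * v t)"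
        using p v by (simp add: ennreal_mult)
      also have "\<dots> \<le> ennreal (v t powr p * K t powr (1 - p) + (p - 1) * w powr p * K t)"
        by (intro ennreal_leI weighted_Young_powr p v K0 True) (use w False in auto)
      also have "\<dots> = ennreal (v t powr p * K t powr (1 - p)) + ennreal ((p - 1) * w powr p) * ennreal (K t)"
        using p K0[OF True] by (simp add: ennreal_plus ennreal_mult)
      finally show ?thesis using True by simp
    qed simp
  qed
  also have "\<dots> = (\<integral>\<^sup>+t\<in>{s<..}. ennreal (v t powr p * K t powr (1 - p)) \<partial>lborel) + ennreal ((p - 1) * w powr p)"
    by (subst nn_integral_add, measurable, subst nn_integral_cmult, measurable) (simp add: K1)
  finally have "ennreal (p * w powr p) \<le> ?V + ennreal ((p - 1) * w powr p)"
    by (simp add: K_def)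
  moreover have "ennreal (p * w powr p) = ennreal (w powr p) + ennreal ((p - 1) * w powr p)"
    using p mult_right_mono[of 1 p "w powr p"]
    by (subst ennreal_plus[symmetric]) (auto simp: algebra_simps)
  ultimately have "ennreal ((p - 1) * w powr p) + ennreal (w powr p) \<le> ennreal ((p - 1) * w powr p) + ?V"
    by (simp add: add.commute)
  then show ?thesis by (subst (asm) ennreal_add_left_cancel_le) simp
qed

text \<open>
  Insert \<open>powr_le_weighted_integral\<close> and exchange the integrals. The choice \<open>\<delta> = (a + 1) / p\<close> makes the
  inner integral converge at \<open>0\<close> and gives the classical sharp constant.
\<close>

theorem Hardy_inequality:
  fixes p a :: real and v w :: "real \<Rightarrow> real"
  assumes p: "1 \<le> p" and a: "-1 < a"
    and v [measurable]: "v \<in> borel_measurable borel" and v0: "\<And>t. 0 \<le> v t"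
    and w: "\<And>s. 0 < s \<Longrightarrow> 0 \<le> w s"
      "\<And>s. 0 < s \<Longrightarrow> ennreal (w s) \<le> (\<integral>\<^sup>+t\<in>{s<..}. ennreal (v t) \<partial>lborel)"
  shows "(\<integral>\<^sup>+s\<in>{0<..}. ennreal (s powr a * w s powr p) \<partial>lborel)
    \<le> ennreal ((p / (a + 1)) powr p) * (\<integral>\<^sup>+t\<in>{0<..}. ennreal (t powr (a + p) * v t powr p) \<partial>lborel)"
proof -
  define \<delta> where "\<delta> = (a + 1) / p"
  have \<delta>: "0 < \<delta>" and \<delta>p: "\<delta> * p = a + 1" using p a by (auto simp: \<delta>_def)
  \<comment> \<open>The integrand of the double integral over \<open>0 < s < t\<close>.\<close>
  define k :: "real \<Rightarrow> real \<Rightarrow> ennreal" where "k s t =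
    ennreal (\<delta> powr (1 - p) * t powr ((1 + \<delta>) * (p - 1)) * v t powr p) *
    (ennreal (s powr (\<delta> - 1)) * indicator {0<..<t} s)" for s t
  have k [measurable]: "(\<lambda>(s, t). k s t) \<in> borel_measurable (lborel \<Otimes>\<^sub>M lborel)"
  proof -
    have [measurable]: "Measurable.pred (lborel \<Otimes>\<^sub>M lborel) (\<lambda>x. fst x \<in> {0<..<snd x::real})"
      unfolding greaterThanLessThan_iff by measurable
    show ?thesis
      unfolding k_def case_prod_beta by measurable
  qed
  have "(\<integral>\<^sup>+s\<in>{0<..}. ennreal (s powr a * w s powr p) \<partial>lborel)
    \<le> (\<integral>\<^sup>+s. \<integral>\<^sup>+t. k s t \<partial>lborel \<partial>lborel)"
  proof (rule nn_integral_mono)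
    fix s :: real
    show "ennreal (s powr a * w s powr p) * indicator {0<..} s \<le> (\<integral>\<^sup>+t. k s t \<partial>lborel)"
    proof (cases "0 < s")
      case True
      have "ennreal (s powr a * w s powr p) = ennreal (s powr a) * ennreal (w s powr p)"
        by (simp add: ennreal_mult)
      also have "\<dots> \<le> ennreal (s powr a) * (\<integral>\<^sup>+t\<in>{s<..}.
          ennreal (v t powr p * (\<delta> * s powr \<delta> * t powr (- 1 - \<delta>)) powr (1 - p)) \<partial>lborel)"
        by (intro mult_left_mono powr_le_weighted_integral p \<delta> True v v0 w) auto
      also have "\<dots> = (\<integral>\<^sup>+t. ennreal (s powr a) *
          (ennreal (v t powr p * (\<delta> * s powr \<delta> * t powr (- 1 - \<delta>)) powr (1 - p)) * indicator {s<..} t) \<partial>lborel)"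
        by (rule nn_integral_cmult[symmetric]) measurable
      also have "\<dots> = (\<integral>\<^sup>+t. k s t \<partial>lborel)"
      proof (rule nn_integral_cong)
        fix t :: real
        have "s powr a * (v t powr p * (\<delta> * s powr \<delta> * t powr (- 1 - \<delta>)) powr (1 - p))
          = \<delta> powr (1 - p) * t powr ((1 + \<delta>) * (p - 1)) * v t powr p * s powr (\<delta> - 1)" if "s < t"
        proof -
          have "(\<delta> * s powr \<delta> * t powr (- 1 - \<delta>)) powr (1 - p)
            = \<delta> powr (1 - p) * s powr (\<delta> * (1 - p)) * t powr ((1 + \<delta>) * (p - 1))"
            using True that \<delta> by (simp add: powr_mult powr_powr algebra_simps)
          moreover have "s powr (\<delta> - 1) = s powr a * s powr (\<delta> * (1 - p))"
            using \<delta>p by (simp add: powr_add[symmetric] algebra_simps)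
          ultimately show ?thesis by (simp only: mult_ac)
        qed
        then show "ennreal (s powr a) *
          (ennreal (v t powr p * (\<delta> * s powr \<delta> * t powr (- 1 - \<delta>)) powr (1 - p)) * indicator {s<..} t) = k s t"
          using True \<delta> by (auto simp: k_def indicator_def ennreal_mult[symmetric])
      qed
      finally show ?thesis using True by simp
    qed simp
  qed
  also have "\<dots> = (\<integral>\<^sup>+t. \<integral>\<^sup>+s. k s t \<partial>lborel \<partial>lborel)"
    by (rule lborel_pair.Fubini'[symmetric]) (use k in simp)
  also have "\<dots> = (\<integral>\<^sup>+t. ennreal ((p / (a + 1)) powr p) *
      (ennreal (t powr (a + p) * v t powr p) * indicator {0<..} t) \<partial>lborel)"
  proof (rule nn_integral_cong)
    fix t :: real
    have "(\<integral>\<^sup>+s. k s t \<partial>lborel) = ennreal (\<delta> powr (1 - p) * t powr ((1 + \<delta>) * (p - 1)) * v t powr p) *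
      (\<integral>\<^sup>+s\<in>{0<..<t}. ennreal (s powr (\<delta> - 1)) \<partial>lborel)"
      unfolding k_def by (rule nn_integral_cmult) measurable
    also have "\<dots> = ennreal ((p / (a + 1)) powr p) * (ennreal (t powr (a + p) * v t powr p) * indicator {0<..} t)"
    proof (cases "0 < t")
      case True
      have "\<delta> powr (1 - p) / \<delta> = (p / (a + 1)) powr p"
      proof -
        have "p / (a + 1) = inverse \<delta>" by (simp add: \<delta>_def)
        then show ?thesis using \<delta> by (simp add: powr_diff inverse_powr powr_minus divide_inverse)
      qed
      moreover have "t powr ((1 + \<delta>) * (p - 1)) * t powr \<delta> = t powr (a + p)"
        using \<delta>p by (simp add: powr_add[symmetric] algebra_simps)
      ultimately have "\<delta> powr (1 - p) * t powr ((1 + \<delta>) * (p - 1)) * v t powr p * (t powr \<delta> / \<delta>)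
        = (p / (a + 1)) powr p * (t powr (a + p) * v t powr p)"
        by (simp only: flip: \<open>_ = (p / (a + 1)) powr p\<close> \<open>_ = t powr (a + p)\<close>) (simp add: mult_ac)
      then show ?thesis using True \<delta> v0 by (simp add: nn_integral_powr_Ioo_0 ennreal_mult[symmetric])
    next
      case False
      then show ?thesis by (auto simp: indicator_def)
    qed
    finally show "(\<integral>\<^sup>+s. k s t \<partial>lborel) = ennreal ((p / (a + 1)) powr p) * (ennreal (t powr (a + p) * v t powr p) * indicator {0<..} t)" .
  qed
  also have "\<dots> = ennreal ((p / (a + 1)) powr p) * (\<integral>\<^sup>+t\<in>{0<..}. ennreal (t powr (a + p) * v t powr p) \<partial>lborel)"
    by (rule nn_integral_cmult) measurable
  finally show ?thesis .
qed

section \<open>Homogeneous polynomials and derivatives of radial functions\<close>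

lemma partial_eq:
  "(F has_derivative F') (at x) \<Longrightarrow> partial i F x = F' (axis i 1)"
  by (simp add: partial_def frechet_derivative_at[symmetric])

lemma has_derivative_nth: "((\<lambda>x. x $ i) has_derivative (\<lambda>h. h $ i)) (at x within S)"
  by (rule bounded_linear.has_derivative[OF bounded_linear_vec_nth has_derivative_ident])

lemma partial_const: "partial i (\<lambda>_. c) = (\<lambda>_. 0)"
  by (rule ext, subst partial_eq[OF has_derivative_const]) simp

lemma partial_add:
  assumes "F differentiable at x" "H differentiable at x"
  shows "partial i (\<lambda>x. F x + H x) x = partial i F x + partial i H x"
  using partial_eq[OF has_derivative_add[OF assms[THEN frechet_derivative_works[THEN iffD1]]]]
  by (simp add: partial_def)

lemma partial_coord_scaleR:
  assumes "F differentiable at x"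
  shows "partial i (\<lambda>x. x $ l *\<^sub>R F x) x = (if i = l then F x else 0) + x $ l *\<^sub>R partial i F x"
proof -
  have "((\<lambda>x. x $ l *\<^sub>R F x) has_derivative
      (\<lambda>h. x $ l *\<^sub>R frechet_derivative F (at x) h + h $ l *\<^sub>R F x)) (at x)"
    by (rule has_derivative_scaleR[OF has_derivative_nth frechet_derivative_works[THEN iffD1, OF assms]])
  from partial_eq[OF this] show ?thesis by (simp add: partial_def axis_def)
qed

text \<open>
  The degree is an integer so that differentiation always lowers it by one; in negative degree
  only the zero function remains (\<open>homogeneous_poly_neg\<close>).
\<close>

inductive homogeneous_poly :: "int \<Rightarrow> (real^'n \<Rightarrow> complex) \<Rightarrow> bool" where
  zero: "homogeneous_poly n (\<lambda>_. 0)"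
| const: "homogeneous_poly 0 (\<lambda>_. c)"
| coord: "homogeneous_poly n P \<Longrightarrow> homogeneous_poly (n + 1) (\<lambda>x. x $ l *\<^sub>R P x)"
| add: "homogeneous_poly n P \<Longrightarrow> homogeneous_poly n Q \<Longrightarrow> homogeneous_poly n (\<lambda>x. P x + Q x)"

lemma homogeneous_poly_neg: "homogeneous_poly n P \<Longrightarrow> n < 0 \<Longrightarrow> P x = 0"
  by (induction rule: homogeneous_poly.induct) auto

lemma homogeneous_poly_bound:
  assumes "homogeneous_poly n P"
  shows "\<exists>C\<ge>0. \<forall>x. x \<noteq> 0 \<longrightarrow> norm (P x) \<le> C * norm x powr n"
  using assms
proof (induction rule: homogeneous_poly.induct)
  case (zero n)
  show ?case by (intro exI[of _ 0]) auto
next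
  case (const c)
  show ?case by (intro exI[of _ "norm c"]) auto
next
  case (coord n P l)
  then obtain C where C: "0 \<le> C" "\<And>x. x \<noteq> 0 \<Longrightarrow> norm (P x) \<le> C * norm x powr n" by blast
  have "norm (x $ l *\<^sub>R P x) \<le> C * norm x powr (n + 1)" if "x \<noteq> 0" for x
  proof -
    have "norm (x $ l *\<^sub>R P x) \<le> norm x * (C * norm x powr n)"
      unfolding norm_scaleR using that C
      by (intro mult_mono) (auto simp: component_le_norm_cart)
    also have "\<dots> = C * norm x powr (n + 1)"
      using that by (simp add: powr_add)
    finally show ?thesis .
  qed
  then show ?case using C(1) by auto
next
  case (add n P Q)
  then obtain C D where C: "0 \<le> C" "\<And>x. x \<noteq> 0 \<Longrightarrow> norm (P x) \<le> C * norm x powr n"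
    and D: "0 \<le> D" "\<And>x. x \<noteq> 0 \<Longrightarrow> norm (Q x) \<le> D * norm x powr n" by blast
  have "norm (P x + Q x) \<le> (C + D) * norm x powr n" if "x \<noteq> 0" for x
    using norm_triangle_ineq[of "P x" "Q x"] C(2)[OF that] D(2)[OF that] by (simp add: algebra_simps)
  then show ?case using C(1) D(1) by (intro exI[of _ "C + D"]) auto
qed

lemma homogeneous_poly_differentiable: "homogeneous_poly n P \<Longrightarrow> P differentiable at x"
proof (induction rule: homogeneous_poly.induct)
  case (coord n P l)
  then show ?case
    using has_derivative_nth[of l x UNIV] by (intro differentiable_scaleR) (auto simp: differentiable_def)
qed (auto intro: differentiable_add)

lemma homogeneous_poly_partial: "homogeneous_poly n P \<Longrightarrow> homogeneous_poly (n - 1) (partial i P)"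
proof (induction rule: homogeneous_poly.induct)
  case (coord n P l)
  have "partial i (\<lambda>x. x $ l *\<^sub>R P x) = (\<lambda>x. (if i = l then P x else 0) + x $ l *\<^sub>R partial i P x)"
    by (rule ext, rule partial_coord_scaleR, rule homogeneous_poly_differentiable[OF coord.hyps])
  moreover have "homogeneous_poly n (\<lambda>x. if i = l then P x else 0)"
    using coord.hyps by (cases "i = l") (auto intro: homogeneous_poly.zero)
  ultimately show ?case
    using homogeneous_poly.coord[OF coord.IH, of l] by (auto intro: homogeneous_poly.add)
next
  case (add n P Q)
  have "partial i (\<lambda>x. P x + Q x) = (\<lambda>x. partial i P x + partial i Q x)"
    by (rule ext, rule partial_add) (rule homogeneous_poly_differentiable, fact)+
  then show ?case using homogeneous_poly.add[OF add.IH] by simp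
qed (auto simp: partial_const intro: homogeneous_poly.zero)

text \<open>
  Symmetry of second derivatives, which for polynomials is an induction over their construction.
\<close>

lemma homogeneous_poly_partial_commute:
  "homogeneous_poly n P \<Longrightarrow> partial i (partial l P) = partial l (partial i P)"
proof (induction rule: homogeneous_poly.induct)
  case (coord n P m)
  note d = homogeneous_poly_differentiable[OF coord.hyps]
    homogeneous_poly_differentiable[OF homogeneous_poly_partial[OF coord.hyps]]
  have *: "partial i (\<lambda>x. x $ m *\<^sub>R P x) = (\<lambda>x. (if i = m then P x else 0) + x $ m *\<^sub>R partial i P x)" for i
    by (rule ext, rule partial_coord_scaleR, rule d)
  have m: "(\<lambda>x. x $ m *\<^sub>R partial l P x) differentiable at x" for l x
    using has_derivative_nth[of m x UNIV] d by (intro differentiable_scaleR) (auto simp: differentiable_def)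
  have if_diff: "(\<lambda>x. if l = m then P x else 0) differentiable at x"
    and if_partial: "partial i (\<lambda>x. if l = m then P x else 0) x = (if l = m then partial i P x else 0)" for i l x
    using d(1) by (cases "l = m"; simp add: partial_const)+
  have "partial i (\<lambda>x. (if l = m then P x else 0) + x $ m *\<^sub>R partial l P x) x =
    (if l = m then partial i P x else 0) + ((if i = m then partial l P x else 0)
      + x $ m *\<^sub>R partial i (partial l P) x)" for i l x
    by (simp only: partial_add[OF if_diff m] if_partial partial_coord_scaleR[OF d(2)])
  then have "partial i (\<lambda>x. (if l = m then P x else 0) + x $ m *\<^sub>R partial l P x) x =
    partial l (\<lambda>x. (if i = m then P x else 0) + x $ m *\<^sub>R partial i P x) x" for x
    by (simp only: coord.IH add.left_commute)
  then show ?case unfolding * by (intro ext)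
next
  case (add n P Q)
  have *: "partial i (\<lambda>x. P x + Q x) = (\<lambda>x. partial i P x + partial i Q x)"
    if "homogeneous_poly n P" "homogeneous_poly n Q" for i n P Q
    by (rule ext, rule partial_add) (rule homogeneous_poly_differentiable, fact)+
  show ?case
    using *[OF add.hyps] *[OF add.hyps[THEN homogeneous_poly_partial]] add.IH by simp
qed (auto simp: partial_const)

text \<open>
  The product and chain rule on coefficients: if a function is \<open>\<Sum>j. P j x * G j (|x|\<^sup>2)\<close> and each
  \<open>G (j + 1)\<close> is the derivative of \<open>G j\<close>, then its \<open>i\<close>-th partial derivative has the coefficients
  \<open>radial_partial i P\<close>.
\<close>

definition radial_partial ::
  "'n \<Rightarrow> (nat \<Rightarrow> real^'n \<Rightarrow> complex) \<Rightarrow> nat \<Rightarrow> real^'n \<Rightarrow> complex" where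
  "radial_partial i P j = (\<lambda>x. partial i (P j) x + x $ i *\<^sub>R (if j = 0 then 0 else 2 * P (j - 1) x))"

definition radial_coeff :: "'n list \<Rightarrow> nat \<Rightarrow> real^'n \<Rightarrow> complex" where
  "radial_coeff is = foldr radial_partial is (\<lambda>j x. if j = 0 then 1 else 0)"

lemma homogeneous_poly_double: "homogeneous_poly n P \<Longrightarrow> homogeneous_poly n (\<lambda>x. 2 * P x)"
  unfolding mult_2 by (rule homogeneous_poly.add)

lemma radial_partial_homogeneous:
  assumes "\<And>j. homogeneous_poly (2 * int j - int m) (P j)"
  shows "homogeneous_poly (2 * int j - int (Suc m)) (radial_partial i P j)"
proof -
  have 1: "homogeneous_poly (2 * int j - int (Suc m)) (partial i (P j))"
    using homogeneous_poly_partial[OF assms[of j], of i] by (simp add: algebra_simps)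
  have 2: "homogeneous_poly (2 * int j - int (Suc m)) (\<lambda>x. x $ i *\<^sub>R (if j = 0 then 0 else 2 * P (j - 1) x))"
  proof (cases j)
    case 0
    then show ?thesis by (simp add: homogeneous_poly.zero)
  next
    case (Suc j')
    have "2 * int j - int (Suc m) = (2 * int j' - int m) + 1" using Suc by simp
    then have "homogeneous_poly (2 * int j - int (Suc m)) (\<lambda>x. x $ i *\<^sub>R (2 * P j' x))"
      using homogeneous_poly.coord[OF homogeneous_poly_double[OF assms[of j']], of i] by (simp only:)
    then show ?thesis using Suc by simp
  qed
  show ?thesis unfolding radial_partial_def by (rule homogeneous_poly.add[OF 1 2])
qed

lemma radial_partial_commute:
  assumes P: "\<And>j. homogeneous_poly (2 * int j - int m) (P j)"
  shows "radial_partial i (radial_partial l P) = radial_partial l (radial_partial i P)"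
proof (intro ext)
  fix j x
  define Q where "Q x = (if j = 0 then 0 else 2 * P (j - 1) x)" for x
  have Q: "homogeneous_poly (if j = 0 then 0 else 2 * int (j - 1) - int m) Q"
  proof (cases "j = 0")
    case True
    then show ?thesis by (simp add: Q_def[abs_def] homogeneous_poly.zero)
  next
    case False
    then show ?thesis
      using homogeneous_poly_double[OF P[of "j - 1"]] by (simp add: Q_def[abs_def])
  qed
  note dQ = homogeneous_poly_differentiable[OF Q]
  have xQ: "(\<lambda>x. x $ l *\<^sub>R Q x) differentiable at x" for l x
    using has_derivative_nth[of l x UNIV] dQ by (intro differentiable_scaleR) (auto simp: differentiable_def)
  have "partial i (radial_partial l P j) x =
     partial i (partial l (P j)) x + ((if i = l then Q x else 0) + x $ l *\<^sub>R partial i Q x)" for i l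
    unfolding radial_partial_def Q_def[symmetric]
    using xQ dQ homogeneous_poly_differentiable[OF homogeneous_poly_partial[OF P]]
    by (subst partial_add) (auto simp: partial_coord_scaleR)
  moreover have "(if j = 0 then 0 else 2 * radial_partial l P (j - 1) x) =
     partial l Q x + x $ l *\<^sub>R (if j \<le> 1 then 0 else 4 * P (j - 2) x)" for l
  proof (cases "j = 0")
    case True
    then have "Q = (\<lambda>_. 0)" by (auto simp: Q_def)
    then show ?thesis using True by (simp add: partial_const)
  next
    case False
    then have Q_eq: "Q = (\<lambda>x. P (j - 1) x + P (j - 1) x)" by (auto simp: Q_def)
    have "partial l Q x = 2 * partial l (P (j - 1)) x"
      unfolding Q_eq using homogeneous_poly_differentiable[OF P] by (subst partial_add) auto
    then show ?thesis using False by (auto simp: radial_partial_def numeral_2_eq_2 le_Suc_eq scaleR_conv_of_real algebra_simps)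
  qed
  ultimately show "radial_partial i (radial_partial l P) j x = radial_partial l (radial_partial i P) j x"
    unfolding radial_partial_def[of i "radial_partial l P"] radial_partial_def[of l "radial_partial i P"]
    by (simp add: homogeneous_poly_partial_commute[OF P, of i l] algebra_simps)
qed

lemma radial_coeff_homogeneous:
  "homogeneous_poly (2 * int j - int (length is)) (radial_coeff is j)"
proof (induction "is" arbitrary: j)
  case Nil
  show ?case
    by (cases j) (auto simp: radial_coeff_def intro: homogeneous_poly.zero homogeneous_poly.const)
next
  case (Cons i "is")
  then show ?case
    using radial_partial_homogeneous[of "length is" "radial_coeff is"] by (simp add: radial_coeff_def)
qed

lemma radial_coeff_eq_0: "length is < j \<Longrightarrow> radial_coeff is j = (\<lambda>_. 0)"
proof (induction "is" arbitrary: j)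
  case (Cons i "is")
  then have "radial_coeff is j = (\<lambda>_. 0)" "radial_coeff is (j - 1) = (\<lambda>_. 0)" by auto
  then show ?case using Cons.prems by (cases j) (simp_all add: radial_coeff_def radial_partial_def partial_const)
qed (auto simp: radial_coeff_def)

text \<open>
  The order in which derivatives are taken does not matter. It suffices to know this for the
  polynomial coefficients, where the operators \<open>radial_partial i\<close> commute.
\<close>

lemma radial_coeff_permute:
  assumes "mset is = mset js"
  shows "radial_coeff is = radial_coeff js"
proof -
  have "fold radial_partial (rev is) (radial_coeff []) = fold radial_partial (rev js) (radial_coeff [])"
  proof (rule fold_permuted_eq[where P = "\<lambda>P. \<exists>m. \<forall>j. homogeneous_poly (2 * int j - int m) (P j)"])
    show "\<exists>m. \<forall>j. homogeneous_poly (2 * int j - int m) (radial_coeff [] j)"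
      using radial_coeff_homogeneous[of _ "[]"] by blast
  next
    fix i l and P :: "nat \<Rightarrow> real^'a \<Rightarrow> complex"
    assume "\<exists>m. \<forall>j. homogeneous_poly (2 * int j - int m) (P j)"
    then obtain m where "\<And>j. homogeneous_poly (2 * int j - int m) (P j)" by blast
    then show "\<exists>m. \<forall>j. homogeneous_poly (2 * int j - int m) (radial_partial i P j)"
      "radial_partial i (radial_partial l P) = radial_partial l (radial_partial i P)"
      by (blast intro: radial_partial_homogeneous, rule radial_partial_commute)
  qed (use assms in simp)
  then show ?thesis by (simp add: radial_coeff_def foldr_conv_fold)
qed

text \<open>
  The common setting of both parts of the theorem: \<open>\<phi>\<close> is radial off the origin of \<open>U\<close>, and \<open>G j\<close> is the
  \<open>j\<close>-th derivative of its profile in \<open>|x|\<^sup>2\<close>. The interval \<open>J\<close> leaves out the origin and the outer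
  end point.
\<close>

locale radial_jet =
  fixes J :: "real set" and U :: "(real^'n) set" and \<phi> :: "real^'n \<Rightarrow> complex"
    and G :: "nat \<Rightarrow> real \<Rightarrow> complex"
  assumes J: "open J" "J \<subseteq> {0<..}"
    and U: "U - {0} = {x. (norm x)\<^sup>2 \<in> J}"
    and G: "\<And>j s. s \<in> J \<Longrightarrow> (G j has_vector_derivative G (Suc j) s) (at s)"
    and \<phi>: "\<And>x. x \<in> U - {0} \<Longrightarrow> \<phi> x = G 0 ((norm x)\<^sup>2)"
begin

lemma open_punctured: "open (U - {0})"
proof -
  have "open ((\<lambda>x::real^'n. (norm x)\<^sup>2) -` J)"
    by (intro open_vimage J continuous_intros)
  then show ?thesis by (simp add: U vimage_def)
qed

end

context radial_jet
begin

lemma has_derivative_G_norm_square: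
  assumes "x \<in> U - {0}"
  shows "((\<lambda>x. G j ((norm x)\<^sup>2)) has_derivative (\<lambda>h. (2 * (x \<bullet> h)) *\<^sub>R G (Suc j) ((norm x)\<^sup>2))) (at x)"
proof -
  have "(norm x)\<^sup>2 \<in> J" using assms U by auto
  then have "(G j has_derivative (\<lambda>h. h *\<^sub>R G (Suc j) ((norm x)\<^sup>2))) (at ((norm x)\<^sup>2))"
    using G by (simp add: has_vector_derivative_def)
  moreover have "((\<lambda>x. (norm x)\<^sup>2) has_derivative (\<lambda>h. 2 * (x \<bullet> h))) (at x)"
    unfolding power2_norm_eq_inner
    by (auto intro!: derivative_eq_intros simp: inner_commute)
  ultimately show ?thesis by (rule has_derivative_compose[rotated])
qed

lemma has_derivative_radial_sum:
  assumes x: "x \<in> U - {0}" and P: "\<And>j. P j differentiable at x"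
  shows "((\<lambda>x. \<Sum>j\<le>n. P j x * G j ((norm x)\<^sup>2)) has_derivative
    (\<lambda>h. \<Sum>j\<le>n. P j x * ((2 * (x \<bullet> h)) *\<^sub>R G (Suc j) ((norm x)\<^sup>2))
      + frechet_derivative (P j) (at x) h * G j ((norm x)\<^sup>2))) (at x)"
  by (rule has_derivative_sum) (rule has_derivative_mult[OF
      frechet_derivative_works[THEN iffD1, OF P] has_derivative_G_norm_square[OF x]])

theorem foldr_partial_eq_radial_sum:
  "x \<in> U - {0} \<Longrightarrow>
    foldr partial is \<phi> x = (\<Sum>j\<le>length is. radial_coeff is j x * G j ((norm x)\<^sup>2))"
proof (induction "is" arbitrary: x)
  case Nil
  then show ?case by (simp add: \<phi> radial_coeff_def)
next
  case (Cons i "is")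
  let ?n = "length is" and ?P = "radial_coeff is" and ?G = "\<lambda>j. G j ((norm x)\<^sup>2)"
  have P: "?P j differentiable at x" for j
    by (rule homogeneous_poly_differentiable[OF radial_coeff_homogeneous])
  have "((foldr partial is \<phi>) has_derivative
    (\<lambda>h. \<Sum>j\<le>?n. ?P j x * ((2 * (x \<bullet> h)) *\<^sub>R ?G (Suc j))
      + frechet_derivative (?P j) (at x) h * ?G j)) (at x)"
    using Cons.IH
    by (intro has_derivative_transform_within_open[OF has_derivative_radial_sum[OF Cons.prems P]
        open_punctured Cons.prems]) simp
  then have "foldr partial (i # is) \<phi> x =
    (\<Sum>j\<le>?n. ?P j x * ((2 * (x \<bullet> axis i 1)) *\<^sub>R ?G (Suc j))
      + frechet_derivative (?P j) (at x) (axis i 1) * ?G j)"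
    by (simp add: partial_eq)
  also have "\<dots> = (\<Sum>j\<le>?n. x $ i *\<^sub>R (2 * ?P j x) * ?G (Suc j)) + (\<Sum>j\<le>?n. partial i (?P j) x * ?G j)"
    by (simp add: sum.distrib[symmetric] partial_def inner_axis scaleR_conv_of_real mult_ac)
  \<comment> \<open>The coefficient of index \<open>Suc ?n\<close> is zero, which gives both sums the same range.\<close>
  also have "(\<Sum>j\<le>?n. partial i (?P j) x * ?G j) = (\<Sum>j\<le>Suc ?n. partial i (?P j) x * ?G j)"
    by (simp add: radial_coeff_eq_0 partial_const)
  also have "(\<Sum>j\<le>?n. x $ i *\<^sub>R (2 * ?P j x) * ?G (Suc j)) =
    (\<Sum>j\<le>Suc ?n. x $ i *\<^sub>R (if j = 0 then 0 else 2 * ?P (j - 1) x) * ?G j)"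
    by (subst sum.atMost_Suc_shift) simp
  finally have "foldr partial (i # is) \<phi> x =
    (\<Sum>j\<le>Suc ?n. x $ i *\<^sub>R (if j = 0 then 0 else 2 * ?P (j - 1) x) * ?G j) +
    (\<Sum>j\<le>Suc ?n. partial i (?P j) x * ?G j)" .
  moreover have "radial_coeff (i # is) j x =
    partial i (?P j) x + x $ i *\<^sub>R (if j = 0 then 0 else 2 * ?P (j - 1) x)" for j
    by (simp add: radial_coeff_def radial_partial_def[of i])
  ultimately show ?case
    by (simp add: distrib_right sum.distrib add.commute del: sum.atMost_Suc)
qed

lemma foldr_partial_differentiable:
  assumes x: "x \<in> U - {0}"
  shows "foldr partial is \<phi> differentiable at x"
proof -
  have "((foldr partial is \<phi>) has_derivative
    (\<lambda>h. \<Sum>j\<le>length is. radial_coeff is j x * ((2 * (x \<bullet> h)) *\<^sub>R G (Suc j) ((norm x)\<^sup>2))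
      + frechet_derivative (radial_coeff is j) (at x) h * G j ((norm x)\<^sup>2))) (at x)"
    by (intro has_derivative_transform_within_open[OF has_derivative_radial_sum open_punctured] x
         homogeneous_poly_differentiable[OF radial_coeff_homogeneous])
       (simp add: foldr_partial_eq_radial_sum)
  then show ?thesis by (auto simp: differentiable_def)
qed

end

lemma ex_count_list: "\<exists>is. \<forall>i::'n::finite. count_list is i = \<alpha> i"
proof -
  obtain "is" where "mset is = Abs_multiset \<alpha>" using ex_mset by blast
  then have "count (mset is) i = \<alpha> i" for i by (simp add: count_Abs_multiset)
  then show ?thesis by (auto simp: count_mset)
qed

text \<open>
  Gives access to the unspecified list of directions behind \<open>mderiv\<close>.
\<close>

lemma mderiv_obtain:
  fixes \<alpha> :: "'n::finite \<Rightarrow> nat"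
  obtains "is" where "\<And>i. count_list is i = \<alpha> i" "length is = (\<Sum>i\<in>UNIV. \<alpha> i)"
    "\<And>\<phi>. mderiv \<alpha> \<phi> = foldr partial is \<phi>"
proof -
  define "is" where "is = (SOME is. \<forall>i. count_list is i = \<alpha> i)"
  have *: "\<forall>i. count_list is i = \<alpha> i" unfolding is_def by (rule someI_ex[OF ex_count_list])
  have "length is = sum (count_list is) UNIV"
    by (rule sum_count_set[symmetric]) auto
  also have "\<dots> = (\<Sum>i\<in>UNIV. \<alpha> i)"
    using * by simp
  finally have "length is = (\<Sum>i\<in>UNIV. \<alpha> i)" .
  moreover have "mderiv \<alpha> \<phi> = foldr partial is \<phi>" for \<phi> :: "real^'n \<Rightarrow> complex"
    by (simp add: mderiv_def is_def)
  ultimately show ?thesis using * that by blast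
qed

lemma finite_multi_indices: "finite {\<alpha> :: 'n::finite \<Rightarrow> nat. (\<Sum>i\<in>UNIV. \<alpha> i) \<le> k}"
proof (rule finite_subset)
  show "{\<alpha>. (\<Sum>i\<in>UNIV. \<alpha> i) \<le> k} \<subseteq> {\<alpha>. \<forall>i. (i \<in> (UNIV::'n set) \<longrightarrow> \<alpha> i \<in> {..k}) \<and> (i \<notin> UNIV \<longrightarrow> \<alpha> i = 0)}"
  proof clarify
    fix \<alpha> :: "'n \<Rightarrow> nat" and i assume "(\<Sum>i\<in>UNIV. \<alpha> i) \<le> k"
    moreover have "\<alpha> i \<le> (\<Sum>i\<in>UNIV. \<alpha> i)" by (rule member_le_sum) auto
    ultimately show "(i \<in> UNIV \<longrightarrow> \<alpha> i \<in> {..k}) \<and> (i \<notin> UNIV \<longrightarrow> \<alpha> i = 0)" by simp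
  qed
  show "finite {\<alpha>. \<forall>i. (i \<in> (UNIV::'n set) \<longrightarrow> \<alpha> i \<in> {..k}) \<and> (i \<notin> UNIV \<longrightarrow> \<alpha> i = 0)}"
    by (rule finite_set_of_finite_funs) auto
qed

lemma finite_multi_indices_eq: "finite {\<alpha> :: 'n::finite \<Rightarrow> nat. (\<Sum>i\<in>UNIV. \<alpha> i) = k}"
  by (rule finite_subset[OF _ finite_multi_indices[of k]]) auto

text \<open>
  The range of \<open>j\<close> reflects the degree \<open>2 * j - m\<close> of the coefficients, and homogeneity bounds them by
  the corresponding power of \<open>|x|\<close>. The constant depends on \<open>\<alpha>\<close> alone, because the coefficients do.
\<close>

lemma mderiv_radial_bound:
  fixes \<alpha> :: "'n::finite \<Rightarrow> nat"
  defines "m \<equiv> (\<Sum>i\<in>UNIV. \<alpha> i)"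
  shows "\<exists>C\<ge>0. \<forall>J U \<phi> G. radial_jet J (U :: (real^'n) set) \<phi> G \<longrightarrow> (\<forall>x\<in>U - {0}.
    norm (mderiv \<alpha> \<phi> x) \<le> C * (\<Sum>j | j \<le> m \<and> m \<le> 2 * j.
      ((norm x)\<^sup>2) powr (real j - m / 2) * norm (G j ((norm x)\<^sup>2))))"
proof -
  obtain "is" where isp: "length is = m" "\<And>\<phi>. mderiv \<alpha> \<phi> = foldr partial is \<phi>"
    unfolding m_def by (rule mderiv_obtain[of \<alpha>]) blast
  have "\<forall>j. \<exists>C. 0 \<le> C \<and> (\<forall>x. x \<noteq> 0 \<longrightarrow>
      norm (radial_coeff is j x) \<le> C * norm x powr real_of_int (2 * int j - int (length is)))"
    using homogeneous_poly_bound[OF radial_coeff_homogeneous[of _ "is"]] by simp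
  from choice[OF this] obtain c where c: "\<And>j. 0 \<le> c j"
    "\<And>j x. x \<noteq> 0 \<Longrightarrow> norm (radial_coeff is j x) \<le> c j * norm x powr real_of_int (2 * int j - int (length is))"
    by blast
  let ?I = "{j. j \<le> m \<and> m \<le> 2 * j}"
  have fin: "finite ?I" by (rule finite_subset[of _ "{..m}"]) auto
  have "norm (mderiv \<alpha> \<phi> x) \<le> (\<Sum>j\<in>?I. c j) * (\<Sum>j\<in>?I.
      ((norm x)\<^sup>2) powr (real j - m / 2) * norm (G j ((norm x)\<^sup>2)))"
    if jet: "radial_jet J U \<phi> G" and x: "x \<in> U - {0}" for J U \<phi> G x
  proof -
    let ?s = "(norm x)\<^sup>2"
    have "mderiv \<alpha> \<phi> x = (\<Sum>j\<le>m. radial_coeff is j x * G j ?s)"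
      unfolding isp(2) by (simp add: radial_jet.foldr_partial_eq_radial_sum[OF jet x] isp(1))
    \<comment> \<open>For \<open>2 * j < m\<close> the coefficient has negative degree and vanishes.\<close>
    also have "\<dots> = (\<Sum>j\<in>?I. radial_coeff is j x * G j ?s)"
    proof (rule sum.mono_neutral_right)
      show "\<forall>j\<in>{..m} - ?I. radial_coeff is j x * G j ?s = 0"
      proof
        fix j assume "j \<in> {..m} - ?I"
        then have "2 * int j - int (length is) < 0" using isp(1) by auto
        then show "radial_coeff is j x * G j ?s = 0"
          using homogeneous_poly_neg[OF radial_coeff_homogeneous[of j "is"]] by simp
      qed
    qed auto
    also have "norm \<dots> \<le> (\<Sum>j\<in>?I. c j * (?s powr (real j - m / 2) * norm (G j ?s)))"
    proof (rule sum_norm_le)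
      fix j assume "j \<in> ?I"
      have "?s powr (real j - m / 2) = norm x powr real_of_int (2 * int j - int (length is))"
      proof -
        have "2 * (real j - m / 2) = real_of_int (2 * int j - int (length is))" by (simp add: isp(1))
        then show ?thesis using x by (simp add: powr_powr flip: powr_numeral)
      qed
      then have "norm (radial_coeff is j x) \<le> c j * ?s powr (real j - m / 2)"
        using c(2)[of x j] x by simp
      then show "norm (radial_coeff is j x * G j ?s) \<le> c j * (?s powr (real j - m / 2) * norm (G j ?s))"
        unfolding norm_mult mult.assoc[symmetric] by (rule mult_right_mono) simp
    qed
    also have "\<dots> \<le> (\<Sum>j\<in>?I. c j * (\<Sum>j\<in>?I. ?s powr (real j - m / 2) * norm (G j ?s)))"
      by (intro sum_mono mult_left_mono c member_le_sum fin) auto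
    finally show ?thesis by (simp add: sum_distrib_right)
  qed
  then show ?thesis
    by (intro exI[of _ "\<Sum>j\<in>?I. c j"] conjI allI impI ballI sum_nonneg c(1))
qed

section \<open>Isotropic derivatives\<close>

text \<open>
  The terms in the expansion of a \<open>k\<close>-fold product of \<open>\<partial>\<^sub>a + \<i> * \<partial>\<^sub>b\<close>.
\<close>

abbreviation words :: "'n \<Rightarrow> 'n \<Rightarrow> nat \<Rightarrow> 'n list set" where
  "words a b k \<equiv> {w. set w \<subseteq> {a, b} \<and> length w = k}"

lemma sum_words_Suc:
  fixes h :: "'n list \<Rightarrow> 'b::comm_monoid_add"
  assumes "a \<noteq> b"
  shows "(\<Sum>w\<in>words a b (Suc k). h w) = (\<Sum>w\<in>words a b k. h (a # w) + h (b # w))"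
proof -
  have "words a b (Suc k) = (#) a ` words a b k \<union> (#) b ` words a b k"
    by (auto simp: length_Suc_conv)
  moreover have "(#) a ` words a b k \<inter> (#) b ` words a b k = {}" using assms by auto
  moreover have "finite (words a b k)" by (rule finite_lists_length_eq) simp
  ultimately show ?thesis
    by (simp add: sum.union_disjoint sum.reindex sum.distrib)
qed

context radial_jet
begin

text \<open>
  The left-hand side is \<open>(\<partial>\<^sub>a + \<i> * \<partial>\<^sub>b)\<^sup>k \<phi>\<close>. In the induction step the derivative of
  \<open>(x\<^sub>a + \<i> * x\<^sub>b) ^ k\<close> in the direction \<open>e\<^sub>a + \<i> * e\<^sub>b\<close> is a multiple of \<open>1 + \<i> * \<i> = 0\<close>.
\<close>

theorem sum_words_foldr_partial:
  assumes ab: "a \<noteq> b"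
  shows "x \<in> U - {0} \<Longrightarrow> (\<Sum>w\<in>words a b k. \<i> ^ count_list w b * foldr partial w \<phi> x)
    = 2 ^ k * Complex (x $ a) (x $ b) ^ k * G k ((norm x)\<^sup>2)"
proof (induction k arbitrary: x)
  case 0
  have words_0: "words a b 0 = {[]}" by auto
  show ?case unfolding words_0 using \<phi>[OF 0] by simp
next
  case (Suc k)
  define F where "F w = frechet_derivative (foldr partial w \<phi>) (at x)" for w
  define D where "D h = (\<Sum>w\<in>words a b k. \<i> ^ count_list w b * F w h)" for h
  let ?z = "\<lambda>x::real^'n. Complex (x $ a) (x $ b)"
  have 1: "((\<lambda>x. \<Sum>w\<in>words a b k. \<i> ^ count_list w b * foldr partial w \<phi> x) has_derivative D) (at x)"
    unfolding D_def F_def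
    by (rule has_derivative_sum) (rule has_derivative_mult_right[OF
      frechet_derivative_works[THEN iffD1, OF foldr_partial_differentiable[OF Suc.prems]]])
  have z: "bounded_linear ?z"
    unfolding Complex_eq
    by (rule bounded_linear_add[OF
          bounded_linear_compose[OF bounded_linear_of_real bounded_linear_vec_nth[of a]]
          bounded_linear_compose[OF bounded_linear_mult_right
            bounded_linear_compose[OF bounded_linear_of_real bounded_linear_vec_nth[of b]]]])
  have 2: "((\<lambda>x. 2 ^ k * ?z x ^ k * G k ((norm x)\<^sup>2)) has_derivative
    (\<lambda>h. 2 ^ k * ?z x ^ k * ((2 * (x \<bullet> h)) *\<^sub>R G (Suc k) ((norm x)\<^sup>2)) +
      2 ^ k * (of_nat k * ?z h * ?z x ^ (k - 1)) * G k ((norm x)\<^sup>2))) (at x)"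
    by (intro has_derivative_mult has_derivative_mult_right has_derivative_power
        has_derivative_G_norm_square Suc.prems bounded_linear.has_derivative[OF z has_derivative_ident])
  \<comment> \<open>By the induction hypothesis the two functions agree near \<open>x\<close>.\<close>
  have D: "D = (\<lambda>h. 2 ^ k * ?z x ^ k * ((2 * (x \<bullet> h)) *\<^sub>R G (Suc k) ((norm x)\<^sup>2)) +
      2 ^ k * (of_nat k * ?z h * ?z x ^ (k - 1)) * G k ((norm x)\<^sup>2))"
    using has_derivative_transform_within_open[OF 1 open_punctured Suc.prems Suc.IH] 2
    by (rule has_derivative_unique)
  have "(\<Sum>w\<in>words a b (Suc k). \<i> ^ count_list w b * foldr partial w \<phi> x) = D (axis a 1) + \<i> * D (axis b 1)"
  proof -
    have "\<i> ^ count_list (a # w) b * foldr partial (a # w) \<phi> x + \<i> ^ count_list (b # w) b * foldr partial (b # w) \<phi> x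
      = \<i> ^ count_list w b * F w (axis a 1) + \<i> * (\<i> ^ count_list w b * F w (axis b 1))" for w
      using ab by (simp add: partial_def F_def)
    then show ?thesis
      unfolding sum_words_Suc[OF ab] D_def sum_distrib_left sum.distrib[symmetric] by (simp only:)
  qed
  also have "\<dots> = 2 ^ k * ?z x ^ k * (2 * ?z x) * G (Suc k) ((norm x)\<^sup>2)"
  proof -
    define A where "A = 2 ^ k * ?z x ^ k * G (Suc k) ((norm x)\<^sup>2)"
    define B where "B = 2 ^ k * (of_nat k * ?z x ^ (k - 1)) * G k ((norm x)\<^sup>2)"
    have nth: "axis a (1::real) $ a = 1" "axis a (1::real) $ b = 0" "axis b (1::real) $ a = 0" "axis b (1::real) $ b = 1"
      using ab by (auto simp: axis_def)
    \<comment> \<open>The terms with \<open>B\<close> will cancel, as they add up to \<open>B * (1 + \<i> * \<i>)\<close>.\<close>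
    have D': "D h = A * of_real (2 * (x \<bullet> h)) + B * ?z h" for h
      unfolding D A_def B_def scaleR_conv_of_real by (simp only: mult_ac)
    have "?z (axis a 1) = 1" "?z (axis b 1) = \<i>"
      by (simp_all only: nth complex_eq_iff complex.sel one_complex.sel imaginary_unit.sel)
    then have "D (axis a 1) + \<i> * D (axis b 1) = A * (2 * (of_real (x $ a) + \<i> * of_real (x $ b)))"
      unfolding D' by (simp add: inner_axis algebra_simps)
    also have "\<dots> = A * (2 * ?z x)" by (simp only: Complex_eq)
    finally show ?thesis unfolding A_def by (simp only: mult_ac)
  qed
  finally show ?case by (simp only: mult_ac power_Suc)
qed

lemma foldr_partial_eq_mderiv:
  assumes "x \<in> U - {0}"
  shows "foldr partial w \<phi> x = mderiv (count_list w) \<phi> x"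
proof -
  obtain "is" where isp: "\<And>i. count_list is i = count_list w i"
    "\<And>\<phi>. mderiv (count_list w) \<phi> = foldr partial is \<phi>"
    by (rule mderiv_obtain[of "count_list w"]) blast
  have mset: "mset is = mset w" using isp(1) by (intro multiset_eqI) (simp add: count_mset)
  show ?thesis
    using radial_coeff_permute[OF mset] arg_cong[OF mset, of size]
    by (simp add: isp(2) foldr_partial_eq_radial_sum[OF assms])
qed

end

text \<open>
  Apply \<open>sum_words_foldr_partial\<close> with \<open>a\<close> a coordinate of maximal modulus at the point \<open>x\<close>, so that
  \<open>|x| \<le> d * |x\<^sub>a| \<le> d * |x\<^sub>a + \<i> * x\<^sub>b|\<close>.
\<close>

lemma radial_derivative_bound:
  assumes "2 \<le> CARD('n::finite)"
  shows "\<exists>C\<ge>0. \<forall>J U \<phi> G. radial_jet J (U :: (real^'n) set) \<phi> G \<longrightarrow> (\<forall>x\<in>U - {0}.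
    ((norm x)\<^sup>2) powr (k / 2) * norm (G k ((norm x)\<^sup>2))
      \<le> C * (\<Sum>\<alpha> | (\<Sum>i\<in>UNIV. \<alpha> i) = k. norm (mderiv \<alpha> \<phi> x)))"
proof (intro exI conjI allI impI ballI)
  show "0 \<le> real CARD('n) ^ k" by simp
  fix J \<phi> G and U :: "(real^'n) set" and x assume jet: "radial_jet J U \<phi> G" and x: "x \<in> U - {0}"
  define S where "S = (\<Sum>\<alpha> | (\<Sum>i\<in>UNIV. \<alpha> i) = k. norm (mderiv \<alpha> \<phi> x))"
  obtain a where a: "\<And>i. \<bar>x $ i\<bar> \<le> \<bar>x $ a\<bar>"
  proof -
    have "Max (range (\<lambda>i. \<bar>x $ i\<bar>)) \<in> range (\<lambda>i. \<bar>x $ i\<bar>)" by (intro Max_in) auto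
    then obtain a where "Max (range (\<lambda>i. \<bar>x $ i\<bar>)) = \<bar>x $ a\<bar>" by blast
    then have "\<bar>x $ i\<bar> \<le> \<bar>x $ a\<bar>" for i by (metis Max_ge finite_imageI finite_UNIV rangeI finite)
    then show ?thesis by (rule that)
  qed
  obtain b where ab: "a \<noteq> b"
  proof -
    have "UNIV \<noteq> {a}"
    proof
      assume "UNIV = {a}"
      then have "CARD('n) = card {a}" by (rule arg_cong)
      then show False using assms by simp
    qed
    then have "\<exists>b. a \<noteq> b" by (metis UNIV_eq_I singletonI)
    then show ?thesis using that by blast
  qed
  let ?z = "Complex (x $ a) (x $ b)"
  have "norm x \<le> (\<Sum>i\<in>UNIV. \<bar>x $ i\<bar>)" by (rule norm_le_l1_cart)
  also have "\<dots> \<le> of_nat CARD('n) * \<bar>x $ a\<bar>" by (rule sum_bounded_above) (rule a)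
  also have "\<bar>x $ a\<bar> \<le> norm ?z" using abs_Re_le_cmod[of ?z] by simp
  finally have nx: "norm x \<le> real CARD('n) * norm ?z" by simp
  have fin: "finite (words a b k)" by (rule finite_lists_length_eq) simp
  have "2 ^ k * (norm ?z ^ k * norm (G k ((norm x)\<^sup>2))) =
     norm (\<Sum>w\<in>words a b k. \<i> ^ count_list w b * foldr partial w \<phi> x)"
    by (simp add: radial_jet.sum_words_foldr_partial[OF jet ab x] norm_mult norm_power)
  also have "\<dots> \<le> (\<Sum>w\<in>words a b k. S)"
  proof (rule sum_norm_le)
    fix w assume w: "w \<in> words a b k"
    have "norm (\<i> ^ count_list w b * foldr partial w \<phi> x) = norm (mderiv (count_list w) \<phi> x)"
      by (simp add: norm_mult norm_power radial_jet.foldr_partial_eq_mderiv[OF jet x])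
    also have "\<dots> \<le> S"
      unfolding S_def using w sum_count_set[of w UNIV]
      by (intro member_le_sum[where f = "\<lambda>\<alpha>. norm (mderiv \<alpha> \<phi> x)"] finite_multi_indices_eq) auto
    finally show "norm (\<i> ^ count_list w b * foldr partial w \<phi> x) \<le> S" .
  qed
  also have "\<dots> = 2 ^ k * S"
    using card_lists_length_eq[of "{a, b}" k] ab by simp
  finally have "norm ?z ^ k * norm (G k ((norm x)\<^sup>2)) \<le> S" by simp
  moreover have "((norm x)\<^sup>2) powr (k / 2) = norm x ^ k"
    using x by (simp add: powr_powr powr_realpow flip: powr_numeral)
  moreover have "norm x ^ k * norm (G k ((norm x)\<^sup>2))
      \<le> real CARD('n) ^ k * (norm ?z ^ k * norm (G k ((norm x)\<^sup>2)))"
    using mult_right_mono[OF power_mono[OF nx norm_ge_zero, of k], of "norm (G k ((norm x)\<^sup>2))"]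
    by (simp add: power_mult_distrib mult.assoc)
  moreover have "real CARD('n) ^ k * (norm ?z ^ k * norm (G k ((norm x)\<^sup>2))) \<le> real CARD('n) ^ k * S"
    if "norm ?z ^ k * norm (G k ((norm x)\<^sup>2)) \<le> S"
    using that by (rule mult_left_mono) simp
  ultimately have "norm x ^ k * norm (G k ((norm x)\<^sup>2)) \<le> real CARD('n) ^ k * S"
    by (meson order_trans)
  then show "((norm x)\<^sup>2) powr (k / 2) * norm (G k ((norm x)\<^sup>2))
    \<le> real CARD('n) ^ k * (\<Sum>\<alpha> | (\<Sum>i\<in>UNIV. \<alpha> i) = k. norm (mderiv \<alpha> \<phi> x))"
    unfolding S_def[symmetric] \<open>((norm x)\<^sup>2) powr (k / 2) = norm x ^ k\<close> .
qed

section \<open>Weighted energies of the profile\<close>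

text \<open>
  The \<open>p\<close>-th power of the norm in \<open>L\<^sup>p\<close> of \<open>x \<mapsto> |x| powr (2 * w) * u (|x|\<^sup>2)\<close> on a \<open>d\<close>-dimensional domain,
  up to a factor, written in the variable \<open>s = |x|\<^sup>2\<close>.
\<close>

definition radial_energy :: "real set \<Rightarrow> real \<Rightarrow> real \<Rightarrow> real \<Rightarrow> (real \<Rightarrow> complex) \<Rightarrow> ennreal" where
  "radial_energy J p d w u =
    (\<integral>\<^sup>+s\<in>J. ennreal (s powr (d / 2 - 1) * (s powr w * norm (u s)) powr p) \<partial>lborel)"

context radial_jet
begin

lemma J_borel [measurable]: "J \<in> sets borel"
  using J(1) by simp

lemma continuous_on_G: "continuous_on J (G j)"
  using G by (auto intro!: continuous_at_imp_continuous_on has_vector_derivative_continuous)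

lemma measurable_G: "(\<lambda>s. indicator J s *\<^sub>R G j s) \<in> borel_measurable borel"
  by (rule borel_measurable_continuous_on_indicator[OF J_borel continuous_on_G])

lemma measurable_weighted_G [measurable]:
  "(\<lambda>s. ennreal ((s powr w * norm (G j s)) powr p) * indicator J s) \<in> borel_measurable borel"
proof -
  note measurable_G[of j, measurable]
  have "(\<lambda>s. ennreal ((s powr w * norm (indicator J s *\<^sub>R G j s)) powr p)) \<in> borel_measurable borel"
    by measurable
  also have "(\<lambda>s. ennreal ((s powr w * norm (indicator J s *\<^sub>R G j s)) powr p)) =
    (\<lambda>s. ennreal ((s powr w * norm (G j s)) powr p) * indicator J s)"
    by (auto simp: indicator_def)
  finally show ?thesis .
qed

lemma radial_energy_eq:
  "radial_energy J p d w (G j) = (\<integral>\<^sup>+s\<in>{0<..}. ennreal (s powr (d / 2 - 1)) *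
     (ennreal ((s powr w * norm (G j s)) powr p) * indicator J s) \<partial>lborel)"
  unfolding radial_energy_def using J(2)
  by (intro nn_integral_cong) (auto simp: indicator_def ennreal_mult)

lemma integral_radial:
  "(\<integral>\<^sup>+x\<in>U. ennreal ((((norm x)\<^sup>2) powr w * norm (G j ((norm x)\<^sup>2))) powr p) \<partial>lborel)
    = ennreal (unit_ball_vol CARD('n) * (CARD('n) / 2)) * radial_energy J p CARD('n) w (G j)"
proof -
  let ?H = "\<lambda>s. ennreal ((s powr w * norm (G j s)) powr p) * indicator J s"
  have "(\<integral>\<^sup>+x\<in>U. ennreal ((((norm x)\<^sup>2) powr w * norm (G j ((norm x)\<^sup>2))) powr p) \<partial>lborel)
    = (\<integral>\<^sup>+x. ?H ((norm (x::real^'n))\<^sup>2) \<partial>lborel)"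
  proof (rule nn_integral_cong_AE)
    show "AE x in lborel. ennreal ((((norm x)\<^sup>2) powr w * norm (G j ((norm x)\<^sup>2))) powr p) * indicator U x
      = ?H ((norm (x::real^'n))\<^sup>2)"
      using AE_lborel_singleton[of 0]
    proof eventually_elim
      case (elim x)
      then have "x \<in> U \<longleftrightarrow> (norm x)\<^sup>2 \<in> J" using U by auto
      then show ?case by (simp add: indicator_def)
    qed
  qed
  also have "\<dots> = ennreal (unit_ball_vol CARD('n) * (CARD('n) / 2)) * radial_energy J p CARD('n) w (G j)"
    unfolding radial_energy_eq by (subst nn_integral_radial) simp_all
  finally show ?thesis .
qed

text \<open>
  Both sides are multiples of the same integral over \<open>x\<close>; comparing them gives the
  substitution \<open>s = \<rho>\<^sup>2\<close>.
\<close>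

lemma integral_profile:
  fixes d :: real
  defines "d \<equiv> real CARD('n)"
  shows "(\<integral>\<^sup>+\<rho>\<in>{\<rho>. 0 < \<rho> \<and> \<rho>\<^sup>2 \<in> J}. ennreal (\<rho> powr (d - 1) * ((\<rho>\<^sup>2) powr w * norm (G j (\<rho>\<^sup>2))) powr p) \<partial>lborel)
    = ennreal (1 / 2) * radial_energy J p d w (G j)"
proof -
  let ?H = "\<lambda>s. ennreal ((s powr w * norm (G j s)) powr p) * indicator J s"
  let ?I = "\<integral>\<^sup>+\<rho>\<in>{\<rho>. 0 < \<rho> \<and> \<rho>\<^sup>2 \<in> J}. ennreal (\<rho> powr (d - 1) * ((\<rho>\<^sup>2) powr w * norm (G j (\<rho>\<^sup>2))) powr p) \<partial>lborel"
  define \<kappa> where "\<kappa> = unit_ball_vol d * d"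
  have \<kappa>: "0 < \<kappa>" by (simp add: \<kappa>_def d_def)
  have "ennreal \<kappa> * ?I = ennreal \<kappa> * (\<integral>\<^sup>+s\<in>{0<..}. ennreal (s powr (d - 1)) * ?H (s\<^sup>2) \<partial>lborel)"
    by (rule arg_cong[where f = "\<lambda>I. ennreal \<kappa> * I"], rule nn_integral_cong)
       (auto simp: indicator_def ennreal_mult)
  also have "\<dots> = (\<integral>\<^sup>+x. ?H ((norm (x::real^'n))\<^sup>2) \<partial>lborel)"
    using nn_integral_radial[of "\<lambda>s. ?H (s\<^sup>2)" 1, where 'a = "real^'n"] by (simp add: \<kappa>_def d_def)
  also have "\<dots> = ennreal (\<kappa> * (1 / 2)) * radial_energy J p d w (G j)"
    unfolding radial_energy_eq by (subst nn_integral_radial) (simp_all add: \<kappa>_def d_def)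
  also have "\<dots> = ennreal \<kappa> * (ennreal (1 / 2) * radial_energy J p d w (G j))"
    using \<kappa> by (subst ennreal_mult) (simp_all add: mult.assoc)
  finally show ?thesis
    using \<kappa> by (subst (asm) ennreal_mult_cancel_left) simp_all
qed

lemma measurable_mderiv [measurable]:
  "(\<lambda>x. ennreal (norm (mderiv \<alpha> \<phi> x) powr p) * indicator (U - {0}) x) \<in> borel_measurable borel"
proof -
  obtain "is" where isp: "mderiv \<alpha> \<phi> = foldr partial is \<phi>"
    by (rule mderiv_obtain[of \<alpha>]) blast
  have "continuous_on (U - {0}) (mderiv \<alpha> \<phi>)"
    unfolding isp
    by (intro continuous_at_imp_continuous_on ballI differentiable_imp_continuous_within foldr_partial_differentiable)
  moreover have "U - {0} \<in> sets borel" using open_punctured by simp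
  ultimately have [measurable]: "(\<lambda>x. indicator (U - {0}) x *\<^sub>R mderiv \<alpha> \<phi> x) \<in> borel_measurable borel"
    by (rule borel_measurable_continuous_on_indicator[rotated])
  have "(\<lambda>x. ennreal (norm (indicator (U - {0}) x *\<^sub>R mderiv \<alpha> \<phi> x) powr p)) \<in> borel_measurable borel"
    by measurable
  also have "(\<lambda>x. ennreal (norm (indicator (U - {0}) x *\<^sub>R mderiv \<alpha> \<phi> x) powr p)) =
    (\<lambda>x. ennreal (norm (mderiv \<alpha> \<phi> x) powr p) * indicator (U - {0}) x)"
    by (auto simp: indicator_def)
  finally show ?thesis .
qed

end

lemma AE_punctured: "AE x in lborel. indicator U x = (indicator (U - {0::real^'n}) x :: ennreal)"
  using AE_lborel_singleton[of 0] by eventually_elim (auto simp: indicator_def)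

lemma nn_integral_punctured:
  "(\<integral>\<^sup>+x\<in>U. h x \<partial>lborel) = (\<integral>\<^sup>+x\<in>U - {0::real^'n}. h x \<partial>lborel)"
  using AE_punctured[of U] by (intro nn_integral_cong_AE) auto

text \<open>
  The integrated form of \<open>mderiv_radial_bound\<close>.
\<close>

lemma mderiv_dominated:
  fixes \<alpha> :: "'n::finite \<Rightarrow> nat" and U :: "(real^'n) set"
  defines "m \<equiv> (\<Sum>i\<in>UNIV. \<alpha> i)"
  assumes p: "1 \<le> p" and jet: "\<And>t. t \<in> X \<Longrightarrow> radial_jet J U (\<Phi> t) (G t)"
  shows "dominated_on X (\<lambda>t. \<integral>\<^sup>+x\<in>U. ennreal (norm (mderiv \<alpha> (\<Phi> t) x) powr p) \<partial>lborel)
    (\<lambda>t. \<Sum>j | j \<le> m \<and> m \<le> 2 * j. radial_energy J p CARD('n) (real j - m / 2) (G t j))"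
proof -
  let ?I = "{j. j \<le> m \<and> m \<le> 2 * j}"
  have fin: "finite ?I" by (rule finite_subset[of _ "{..m}"]) auto
  from mderiv_radial_bound[of \<alpha>] obtain C where C0: "0 \<le> C \<and> (\<forall>J U \<phi> G. radial_jet J (U :: (real^'n) set) \<phi> G \<longrightarrow>
    (\<forall>x\<in>U - {0}. norm (mderiv \<alpha> \<phi> x) \<le> C * (\<Sum>j\<in>?I. ((norm x)\<^sup>2) powr (real j - m / 2) * norm (G j ((norm x)\<^sup>2)))))"
    unfolding m_def ..
  note C = C0[THEN conjunct1] and bound = C0[THEN conjunct2, rule_format]
  define c where "c = C powr p * real (card ?I) powr p"
  define \<kappa> where "\<kappa> = unit_ball_vol CARD('n) * (CARD('n) / 2)"
  show ?thesis
  proof (rule dominated_onI[of "c * \<kappa>"])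
    show "0 \<le> c * \<kappa>" by (simp add: c_def \<kappa>_def)
    fix t assume "t \<in> X"
    then interpret radial_jet J U "\<Phi> t" "G t" by (rule jet)
    let ?y = "\<lambda>j x. ((norm x)\<^sup>2) powr (real j - m / 2) * norm (G t j ((norm x)\<^sup>2))"
    have meas: "(\<lambda>x::real^'n. ennreal (?y j x powr p) * indicator (U - {0}) x) \<in> borel_measurable lborel" for j
    proof -
      have "(\<lambda>x. ennreal (?y j x powr p) * indicator (U - {0}) x) =
        (\<lambda>x::real^'n. (\<lambda>s. ennreal ((s powr (real j - m / 2) * norm (G t j s)) powr p) * indicator J s) ((norm x)\<^sup>2))"
        by (simp only: U indicator_def mem_Collect_eq)
      also have "\<dots> \<in> borel_measurable borel"
        by (rule measurable_compose[OF _ measurable_weighted_G]) measurable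
      finally show ?thesis by simp
    qed
    have "(\<integral>\<^sup>+x\<in>U. ennreal (norm (mderiv \<alpha> (\<Phi> t) x) powr p) \<partial>lborel)
      \<le> (\<integral>\<^sup>+x. ennreal c * (\<Sum>j\<in>?I. ennreal (?y j x powr p) * indicator (U - {0}) x) \<partial>lborel)"
      unfolding nn_integral_punctured[of _ U]
    proof (rule nn_integral_mono)
      fix x :: "real^'n"
      show "ennreal (norm (mderiv \<alpha> (\<Phi> t) x) powr p) * indicator (U - {0}) x
        \<le> ennreal c * (\<Sum>j\<in>?I. ennreal (?y j x powr p) * indicator (U - {0}) x)"
      proof (cases "x \<in> U - {0}")
        case True
        have "norm (mderiv \<alpha> (\<Phi> t) x) powr p \<le> (C * (\<Sum>j\<in>?I. ?y j x)) powr p"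
          using p by (intro powr_mono2 bound[OF radial_jet_axioms True]) auto
        also have "\<dots> = C powr p * (\<Sum>j\<in>?I. ?y j x) powr p"
          by (rule powr_mult)
        also have "\<dots> \<le> C powr p * (real (card ?I) powr p * (\<Sum>j\<in>?I. ?y j x powr p))"
          using p fin by (intro mult_left_mono powr_sum_le) auto
        also have "\<dots> = c * (\<Sum>j\<in>?I. ?y j x powr p)" by (simp add: c_def)
        finally have "ennreal (norm (mderiv \<alpha> (\<Phi> t) x) powr p) \<le> ennreal (c * (\<Sum>j\<in>?I. ?y j x powr p))"
          by (rule ennreal_leI)
        also have "\<dots> = ennreal c * (\<Sum>j\<in>?I. ennreal (?y j x powr p))"
          by (subst ennreal_mult) (auto simp: c_def sum_nonneg sum_ennreal)
        finally show ?thesis using True by simp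
      qed simp
    qed
    also have "\<dots> = ennreal c * (\<integral>\<^sup>+x. (\<Sum>j\<in>?I. ennreal (?y j x powr p) * indicator (U - {0}) x) \<partial>lborel)"
      by (rule nn_integral_cmult) (intro borel_measurable_sum meas)
    also have "(\<integral>\<^sup>+x. (\<Sum>j\<in>?I. ennreal (?y j x powr p) * indicator (U - {0}) x) \<partial>lborel)
      = (\<Sum>j\<in>?I. \<integral>\<^sup>+x\<in>U. ennreal (?y j x powr p) \<partial>lborel)"
      unfolding nn_integral_punctured[of _ U] by (rule nn_integral_sum) (rule meas)
    also have "\<dots> = (\<Sum>j\<in>?I. ennreal \<kappa> * radial_energy J p CARD('n) (real j - m / 2) (G t j))"
      by (simp only: integral_radial \<kappa>_def)
    finally have le: "(\<integral>\<^sup>+x\<in>U. ennreal (norm (mderiv \<alpha> (\<Phi> t) x) powr p) \<partial>lborel) \<le>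
      ennreal c * (\<Sum>j\<in>?I. ennreal \<kappa> * radial_energy J p CARD('n) (real j - m / 2) (G t j))" .
    show "(\<integral>\<^sup>+x\<in>U. ennreal (norm (mderiv \<alpha> (\<Phi> t) x) powr p) \<partial>lborel) \<le>
      ennreal (c * \<kappa>) * (\<Sum>j\<in>?I. radial_energy J p CARD('n) (real j - m / 2) (G t j))"
    proof -
      have "ennreal (c * \<kappa>) = ennreal c * ennreal \<kappa>"
        by (rule ennreal_mult) (simp_all add: c_def \<kappa>_def)
      then show ?thesis using le by (simp only: mult.assoc sum_distrib_left)
    qed
  qed
qed

text \<open>
  The integrated form of \<open>radial_derivative_bound\<close>.
\<close>

lemma radial_energy_dominated_by_mderiv:
  fixes U :: "(real^'n::finite) set"
  assumes n: "2 \<le> CARD('n)" and p: "1 \<le> p" and jet: "\<And>t. t \<in> X \<Longrightarrow> radial_jet J U (\<Phi> t) (G t)"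
  shows "dominated_on X (\<lambda>t. radial_energy J p CARD('n) (real k / 2) (G t k))
    (\<lambda>t. \<Sum>\<alpha> | (\<Sum>i\<in>UNIV. \<alpha> i) = k. \<integral>\<^sup>+x\<in>U. ennreal (norm (mderiv \<alpha> (\<Phi> t) x) powr p) \<partial>lborel)"
proof -
  let ?I = "{\<alpha> :: 'n \<Rightarrow> nat. (\<Sum>i\<in>UNIV. \<alpha> i) = k}"
  note fin = finite_multi_indices_eq[where 'n = 'n and k = k]
  from radial_derivative_bound[OF n, of k] obtain C where C0: "0 \<le> C \<and> (\<forall>J U \<phi> G. radial_jet J (U :: (real^'n) set) \<phi> G \<longrightarrow>
    (\<forall>x\<in>U - {0}. ((norm x)\<^sup>2) powr (k / 2) * norm (G k ((norm x)\<^sup>2)) \<le> C * (\<Sum>\<alpha>\<in>?I. norm (mderiv \<alpha> \<phi> x))))"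
    ..
  note C = C0[THEN conjunct1] and bound = C0[THEN conjunct2, rule_format]
  define c where "c = C powr p * real (card ?I) powr p"
  define \<kappa> where "\<kappa> = unit_ball_vol CARD('n) * (CARD('n) / 2)"
  have \<kappa>: "0 < \<kappa>" by (simp add: \<kappa>_def)
  show ?thesis
  proof (rule dominated_onI[of "1 / \<kappa> * c"])
    show "0 \<le> 1 / \<kappa> * c" using \<kappa> by (simp add: c_def)
    fix t assume "t \<in> X"
    then interpret radial_jet J U "\<Phi> t" "G t" by (rule jet)
    let ?y = "\<lambda>x. ((norm x)\<^sup>2) powr (k / 2) * norm (G t k ((norm x)\<^sup>2))"
    let ?m = "\<lambda>\<alpha> x. norm (mderiv \<alpha> (\<Phi> t) x)"
    have meas: "(\<lambda>x. ennreal (?m \<alpha> x powr p) * indicator (U - {0}) x) \<in> borel_measurable lborel" for \<alpha>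
      using measurable_mderiv by simp
    have "ennreal \<kappa> * radial_energy J p CARD('n) (real k / 2) (G t k) = (\<integral>\<^sup>+x\<in>U. ennreal (?y x powr p) \<partial>lborel)"
      unfolding \<kappa>_def by (rule integral_radial[symmetric])
    also have "\<dots> \<le> (\<integral>\<^sup>+x. ennreal c * (\<Sum>\<alpha>\<in>?I. ennreal (?m \<alpha> x powr p) * indicator (U - {0}) x) \<partial>lborel)"
      unfolding nn_integral_punctured[of _ U]
    proof (rule nn_integral_mono)
      fix x :: "real^'n"
      show "ennreal (?y x powr p) * indicator (U - {0}) x
        \<le> ennreal c * (\<Sum>\<alpha>\<in>?I. ennreal (?m \<alpha> x powr p) * indicator (U - {0}) x)"
      proof (cases "x \<in> U - {0}")
        case True
        have "?y x powr p \<le> (C * (\<Sum>\<alpha>\<in>?I. ?m \<alpha> x)) powr p"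
          using p by (intro powr_mono2 bound[OF radial_jet_axioms True]) auto
        also have "\<dots> = C powr p * (\<Sum>\<alpha>\<in>?I. ?m \<alpha> x) powr p"
          by (rule powr_mult)
        also have "\<dots> \<le> C powr p * (real (card ?I) powr p * (\<Sum>\<alpha>\<in>?I. ?m \<alpha> x powr p))"
          using p fin by (intro mult_left_mono powr_sum_le) auto
        also have "\<dots> = c * (\<Sum>\<alpha>\<in>?I. ?m \<alpha> x powr p)" by (simp add: c_def)
        finally have "ennreal (?y x powr p) \<le> ennreal (c * (\<Sum>\<alpha>\<in>?I. ?m \<alpha> x powr p))"
          by (rule ennreal_leI)
        also have "\<dots> = ennreal c * (\<Sum>\<alpha>\<in>?I. ennreal (?m \<alpha> x powr p))"
          by (subst ennreal_mult) (auto simp: c_def sum_nonneg sum_ennreal)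
        finally show ?thesis using True by simp
      qed simp
    qed
    also have "\<dots> = ennreal c * (\<integral>\<^sup>+x. (\<Sum>\<alpha>\<in>?I. ennreal (?m \<alpha> x powr p) * indicator (U - {0}) x) \<partial>lborel)"
      by (rule nn_integral_cmult) (intro borel_measurable_sum meas)
    also have "(\<integral>\<^sup>+x. (\<Sum>\<alpha>\<in>?I. ennreal (?m \<alpha> x powr p) * indicator (U - {0}) x) \<partial>lborel)
      = (\<Sum>\<alpha>\<in>?I. \<integral>\<^sup>+x\<in>U. ennreal (?m \<alpha> x powr p) \<partial>lborel)"
      unfolding nn_integral_punctured[of _ U] by (rule nn_integral_sum) (rule meas)
    finally have "ennreal (1 / \<kappa>) * (ennreal \<kappa> * radial_energy J p CARD('n) (real k / 2) (G t k))
      \<le> ennreal (1 / \<kappa>) * (ennreal c * (\<Sum>\<alpha>\<in>?I. \<integral>\<^sup>+x\<in>U. ennreal (?m \<alpha> x powr p) \<partial>lborel))"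
      by (rule mult_left_mono) simp
    then show "radial_energy J p CARD('n) (real k / 2) (G t k)
      \<le> ennreal (1 / \<kappa> * c) * (\<Sum>\<alpha>\<in>?I. \<integral>\<^sup>+x\<in>U. ennreal (?m \<alpha> x powr p) \<partial>lborel)"
      using \<kappa> by (simp add: mult.assoc[symmetric] ennreal_mult[symmetric] c_def)
  qed
qed

section \<open>Hardy's inequality for the energies\<close>

text \<open>
  The fundamental theorem of calculus supplies the hypothesis of Hardy's inequality for functions that
  vanish at some point \<open>b\<close>.
\<close>

lemma norm_le_nn_integral_derivative:
  fixes F F' :: "real \<Rightarrow> complex" and v :: "real \<Rightarrow> real"
  assumes sb: "s \<le> b" and cont: "continuous_on {s..b} F" and Fb: "F b = 0"
    and F': "\<And>t. s < t \<Longrightarrow> t < b \<Longrightarrow> (F has_vector_derivative F' t) (at t)"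
    and v: "\<And>t. s < t \<Longrightarrow> t < b \<Longrightarrow> norm (F' t) \<le> v t"
    and meas: "(\<lambda>t. v t * indicator {s<..<b} t) \<in> borel_measurable borel"
  shows "ennreal (norm (F s)) \<le> (\<integral>\<^sup>+t\<in>{s<..<b}. ennreal (v t) \<partial>lborel)"
proof (cases "(\<integral>\<^sup>+t\<in>{s<..<b}. ennreal (v t) \<partial>lborel) = \<infinity>")
  case False
  define g where "g t = v t * indicator {s<..<b} t" for t
  define f where "f t = (if s < t \<and> t < b then F' t else 0)" for t
  have v0: "0 \<le> v t" if "s < t" "t < b" for t
    using v[OF that] norm_ge_zero[of "F' t"] by linarith
  then have g0: "0 \<le> g t" for t by (auto simp: g_def indicator_def)
  have nn_g: "(\<integral>\<^sup>+t. ennreal (g t) \<partial>lborel) = (\<integral>\<^sup>+t\<in>{s<..<b}. ennreal (v t) \<partial>lborel)"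
    by (intro nn_integral_cong) (auto simp: g_def indicator_def)
  moreover have "g \<in> borel_measurable lborel" using meas by (simp add: g_def[abs_def])
  ultimately have int: "integrable lborel g"
    using False g0 by (auto intro!: integrableI_nonneg simp: less_top)
  have int_eq: "ennreal (integral\<^sup>L lborel g) = (\<integral>\<^sup>+t\<in>{s<..<b}. ennreal (v t) \<partial>lborel)"
    using nn_integral_eq_integral[OF int] g0 nn_g by simp
  have "(g has_integral integral\<^sup>L lborel g) UNIV"
    by (rule has_integral_integral_lborel[OF int])
  moreover have "(\<lambda>t. if t \<in> {s..b} then g t else 0) = g"
    by (rule ext) (auto simp: g_def indicator_def)
  ultimately have g: "(g has_integral integral\<^sup>L lborel g) {s..b}"
    using has_integral_restrict_UNIV[of "{s..b}" g] by simp
  have f: "(f has_integral F b - F s) {s..b}"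
    by (rule fundamental_theorem_of_calculus_interior[OF sb cont]) (use F' in \<open>simp add: f_def\<close>)
  have "norm (F b - F s) \<le> integral\<^sup>L lborel g"
    using integral_norm_bound_integral[of f "{s..b}" g] f g v
    by (auto simp: f_def g_def has_integral_iff)
  then have "ennreal (norm (F s)) \<le> ennreal (integral\<^sup>L lborel g)"
    using Fb by (intro ennreal_leI) simp
  then show ?thesis by (simp only: int_eq)
qed simp

lemma radial_energy_weight:
  "radial_energy J p d w u = (\<integral>\<^sup>+s\<in>J. ennreal (s powr (d / 2 - 1 + w * p) * norm (u s) powr p) \<partial>lborel)"
  unfolding radial_energy_def by (simp add: powr_mult powr_powr powr_add mult.assoc)

lemma nn_integral_linear:
  fixes a b :: ennreal
  assumes [measurable]: "f \<in> borel_measurable M" "g \<in> borel_measurable M"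
  shows "(\<integral>\<^sup>+x. a * (f x + b * g x) \<partial>M) = a * ((\<integral>\<^sup>+x. f x \<partial>M) + b * (\<integral>\<^sup>+x. g x \<partial>M))"
  by (simp add: nn_integral_cmult nn_integral_add)

text \<open>
  Hardy's inequality for a jet that vanishes near infinity. The exponent \<open>d / 2 - 1 + w * p\<close> of the weight
  exceeds \<open>-1\<close>, as Hardy's inequality demands, because \<open>w\<close> is nonnegative.
\<close>

lemma radial_energy_dominated_by_derivative:
  fixes U :: "(real^'n::finite) set"
  assumes p: "1 \<le> p" and d: "0 < d" and w: "0 \<le> w"
    and jet: "\<And>t. t \<in> X \<Longrightarrow> radial_jet {0<..} U (\<Phi> t) (G t)"
    and vanish: "\<And>t. t \<in> X \<Longrightarrow> \<exists>b. \<forall>j s. b \<le> s \<longrightarrow> G t j s = 0"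
  shows "dominated_on X (\<lambda>t. radial_energy {0<..} p d w (G t j))
    (\<lambda>t. radial_energy {0<..} p d (w + 1) (G t (Suc j)))"
proof (rule dominated_onI)
  let ?a = "d / 2 - 1 + w * p"
  have a: "-1 < ?a"
  proof -
    have "0 \<le> w * p" using p w by simp
    then show ?thesis using d by linarith
  qed
  fix t assume t: "t \<in> X"
  then interpret radial_jet "{0<..}" U "\<Phi> t" "G t" by (rule jet)
  obtain b where b: "\<And>j s. b \<le> s \<Longrightarrow> G t j s = 0" using vanish[OF t] by blast
  define v where "v s = norm (indicator {0<..} s *\<^sub>R G t (Suc j) s)" for s
  have v [measurable]: "v \<in> borel_measurable borel"
    unfolding v_def using measurable_G by measurable
  have "(\<integral>\<^sup>+s\<in>{0<..}. ennreal (s powr ?a * norm (G t j s) powr p) \<partial>lborel)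
    \<le> ennreal ((p / (?a + 1)) powr p) * (\<integral>\<^sup>+s\<in>{0<..}. ennreal (s powr (?a + p) * v s powr p) \<partial>lborel)"
  proof (rule Hardy_inequality[OF p a v])
    fix s :: real assume s: "0 < s"
    show "ennreal (norm (G t j s)) \<le> (\<integral>\<^sup>+x\<in>{s<..}. ennreal (v x) \<partial>lborel)"
    proof (cases "b \<le> s")
      case True
      then show ?thesis by (simp add: b)
    next
      case False
      have "ennreal (norm (G t j s)) \<le> (\<integral>\<^sup>+x\<in>{s<..<b}. ennreal (v x) \<partial>lborel)"
      proof (rule norm_le_nn_integral_derivative)
        show "continuous_on {s..b} (G t j)"
          by (rule continuous_on_subset[OF continuous_on_G]) (use s in auto)
        show "(G t j has_vector_derivative G t (Suc j) x) (at x)" if "s < x" for x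
          using s that by (intro G) simp
        show "norm (G t (Suc j) x) \<le> v x" if "s < x" for x
          using s that by (simp add: v_def)
      qed (use False b in \<open>simp_all\<close>)
      also have "\<dots> \<le> (\<integral>\<^sup>+x\<in>{s<..}. ennreal (v x) \<partial>lborel)"
        by (intro nn_integral_mono) (auto simp: indicator_def)
      finally show ?thesis .
    qed
  qed (auto simp: v_def)
  moreover have "(\<integral>\<^sup>+s\<in>{0<..}. ennreal (s powr (?a + p) * v s powr p) \<partial>lborel) =
    radial_energy {0<..} p d (w + 1) (G t (Suc j))"
    unfolding radial_energy_weight v_def by (intro nn_integral_cong) (auto simp: indicator_def algebra_simps)
  ultimately show "radial_energy {0<..} p d w (G t j)
      \<le> ennreal ((p / (?a + 1)) powr p) * radial_energy {0<..} p d (w + 1) (G t (Suc j))"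
    unfolding radial_energy_weight[of _ _ _ w] by simp
qed simp

text \<open>
  On a bounded interval \<open>F s = (1 - s / R) * G j s\<close> vanishes at \<open>R\<close>, so Hardy's inequality applies to \<open>F\<close>.
  The remainder \<open>s / R * G j s\<close>, and the term of the derivative of \<open>F\<close> that differentiates the cut-off, already
  carry the weight \<open>w + 1\<close>, with \<open>G j\<close> itself in place of its derivative.
\<close>

lemma radial_energy_dominated_by_derivative_bounded:
  fixes U :: "(real^'n::finite) set"
  assumes p: "1 \<le> p" and d: "0 < d" and w: "0 \<le> w" and R: "0 < R"
    and jet: "\<And>t. t \<in> X \<Longrightarrow> radial_jet {0<..<R} U (\<Phi> t) (G t)"
    and cont: "\<And>t. t \<in> X \<Longrightarrow> continuous_on {0<..R} (G t j)"
  shows "dominated_on X (\<lambda>t. radial_energy {0<..<R} p d w (G t j))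
    (\<lambda>t. radial_energy {0<..<R} p d (w + 1) (G t j) + radial_energy {0<..<R} p d (w + 1) (G t (Suc j)))"
proof (rule dominated_onI)
  let ?a = "d / 2 - 1 + w * p"
  define C where "C = (p / (?a + 1)) powr p"
  \<comment> \<open>\<open>C\<close> stems from Hardy's inequality, and each factor \<open>2 powr p\<close> from \<open>powr_add_le\<close>.\<close>
  define K where "K = 2 powr p * (C * 2 powr p * (1 + (1 / R) powr p) + (1 / R) powr p)"
  have a: "-1 < ?a"
  proof -
    have "0 \<le> w * p" using p w by simp
    then show ?thesis using d by linarith
  qed
  show "0 \<le> K" by (auto simp: K_def C_def)
  fix t assume t: "t \<in> X"
  then interpret radial_jet "{0<..<R}" U "\<Phi> t" "G t" by (rule jet)
  let ?J = "indicator {0<..<R} :: real \<Rightarrow> real"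
  define F where "F s = (1 - s / R) *\<^sub>R G t j s" for s
  define F' where "F' s = (1 - s / R) *\<^sub>R G t (Suc j) s - (1 / R) *\<^sub>R G t j s" for s
  define v where "v s = norm (?J s *\<^sub>R G t (Suc j) s) + norm (?J s *\<^sub>R G t j s) / R" for s
  have v [measurable]: "v \<in> borel_measurable borel"
    unfolding v_def using measurable_G[of j] measurable_G[of "Suc j"] by measurable
  let ?E = "\<lambda>w i. radial_energy {0<..<R} p d w (G t i)"
  have meas: "(\<lambda>s. ennreal (s powr e * norm (?J s *\<^sub>R G t i s) powr p)) \<in> borel_measurable lborel" for e i
    using measurable_G[of i] by measurable
  have E: "?E w i = (\<integral>\<^sup>+s. ennreal (s powr (d / 2 - 1 + w * p) * norm (?J s *\<^sub>R G t i s) powr p) \<partial>lborel)" for w i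
    unfolding radial_energy_weight by (intro nn_integral_cong) (auto simp: indicator_def)
  have Hardy: "(\<integral>\<^sup>+s\<in>{0<..}. ennreal (s powr ?a * norm (?J s *\<^sub>R F s) powr p) \<partial>lborel)
    \<le> ennreal C * (\<integral>\<^sup>+s\<in>{0<..}. ennreal (s powr (?a + p) * v s powr p) \<partial>lborel)"
    unfolding C_def
  proof (rule Hardy_inequality[OF p a v])
    fix s :: real assume s: "0 < s"
    show "ennreal (norm (?J s *\<^sub>R F s)) \<le> (\<integral>\<^sup>+x\<in>{s<..}. ennreal (v x) \<partial>lborel)"
    proof (cases "R \<le> s")
      case True
      then show ?thesis by simp
    next
      case False
      have "ennreal (norm (F s)) \<le> (\<integral>\<^sup>+x\<in>{s<..<R}. ennreal (v x) \<partial>lborel)"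
      proof (rule norm_le_nn_integral_derivative)
        show "continuous_on {s..R} F"
          unfolding F_def by (intro continuous_intros continuous_on_subset[OF cont[OF t]]) (use s R in auto)
        fix x assume x: "s < x" "x < R"
        show "(F has_vector_derivative F' x) (at x)"
        proof -
          have "((\<lambda>s. 1 - s / R) has_field_derivative (- (1 / R))) (at x)"
            using R by (auto intro!: derivative_eq_intros)
          from has_vector_derivative_scaleR[OF this G[of x j]] show ?thesis
            unfolding F_def[abs_def] F'_def using s x by simp
        qed
        have "norm (F' x) \<le> norm ((1 - x / R) *\<^sub>R G t (Suc j) x) + norm ((1 / R) *\<^sub>R G t j x)"
          unfolding F'_def by (rule norm_triangle_ineq4)
        also have "\<dots> \<le> norm (G t (Suc j) x) + norm ((1 / R) *\<^sub>R G t j x)"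
        proof (rule add_right_mono)
          have "\<bar>1 - x / R\<bar> \<le> 1" using s x R by (simp add: abs_le_iff)
          then show "norm ((1 - x / R) *\<^sub>R G t (Suc j) x) \<le> norm (G t (Suc j) x)"
            unfolding norm_scaleR by (intro mult_left_le_one_le) auto
        qed
        also have "\<dots> = v x"
          using s x R by (simp add: v_def)
        finally show "norm (F' x) \<le> v x" .
      qed (use False R in \<open>simp_all add: F_def\<close>)
      also have "\<dots> \<le> (\<integral>\<^sup>+x\<in>{s<..}. ennreal (v x) \<partial>lborel)"
        by (intro nn_integral_mono) (auto simp: indicator_def)
      finally show ?thesis using s False by simp
    qed
  qed (use R in \<open>auto simp: v_def\<close>)
  have "(\<integral>\<^sup>+s\<in>{0<..}. ennreal (s powr (?a + p) * v s powr p) \<partial>lborel)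
    \<le> (\<integral>\<^sup>+s. ennreal (2 powr p) * (ennreal (s powr (d / 2 - 1 + (w + 1) * p) * norm (?J s *\<^sub>R G t (Suc j) s) powr p) +
      ennreal ((1 / R) powr p) * ennreal (s powr (d / 2 - 1 + (w + 1) * p) * norm (?J s *\<^sub>R G t j s) powr p)) \<partial>lborel)"
  proof (rule nn_integral_mono)
    fix s :: real
    define x where "x = norm (?J s *\<^sub>R G t (Suc j) s)"
    define y where "y = norm (?J s *\<^sub>R G t j s)"
    define e where "e = d / 2 - 1 + (w + 1) * p"
    have e: "?a + p = e" by (simp add: e_def algebra_simps)
    have "v s powr p = (x + 1 / R * y) powr p"
      by (simp add: v_def x_def y_def)
    also have "\<dots> \<le> 2 powr p * (x powr p + (1 / R * y) powr p)"
      using p R by (intro powr_add_le) (simp_all add: x_def y_def)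
    finally have "s powr e * v s powr p \<le> s powr e * (2 powr p * (x powr p + (1 / R) powr p * y powr p))"
      unfolding powr_mult by (rule mult_left_mono) simp
    also have "\<dots> = 2 powr p * (s powr e * x powr p + (1 / R) powr p * (s powr e * y powr p))"
      by (simp only: distrib_left mult_ac)
    finally have "ennreal (s powr e * v s powr p) \<le>
      ennreal (2 powr p * (s powr e * x powr p + (1 / R) powr p * (s powr e * y powr p)))"
      by (rule ennreal_leI)
    also have "\<dots> = ennreal (2 powr p) * (ennreal (s powr e * x powr p) + ennreal ((1 / R) powr p) * ennreal (s powr e * y powr p))"
      by (subst ennreal_mult, simp, simp, subst ennreal_plus, simp, simp, subst ennreal_mult[of "(1 / R) powr p"]) simp_all
    finally have "ennreal (s powr e * v s powr p) * indicator {0<..} s \<le>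
      ennreal (2 powr p) * (ennreal (s powr e * x powr p) + ennreal ((1 / R) powr p) * ennreal (s powr e * y powr p))"
      by (cases "s \<in> {0<..}") simp_all
    then show "ennreal (s powr (?a + p) * v s powr p) * indicator {0<..} s \<le>
       ennreal (2 powr p) * (ennreal (s powr (d / 2 - 1 + (w + 1) * p) * norm (?J s *\<^sub>R G t (Suc j) s) powr p) +
       ennreal ((1 / R) powr p) * ennreal (s powr (d / 2 - 1 + (w + 1) * p) * norm (?J s *\<^sub>R G t j s) powr p))"
      unfolding e unfolding e_def x_def y_def .
  qed
  also have "\<dots> = ennreal (2 powr p) * (?E (w + 1) (Suc j) + ennreal ((1 / R) powr p) * ?E (w + 1) j)"
    unfolding E by (rule nn_integral_linear[OF meas meas])
  finally have v_le: "(\<integral>\<^sup>+s\<in>{0<..}. ennreal (s powr (?a + p) * v s powr p) \<partial>lborel)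
    \<le> ennreal (2 powr p) * (?E (w + 1) (Suc j) + ennreal ((1 / R) powr p) * ?E (w + 1) j)" .
  have F: "(\<integral>\<^sup>+s\<in>{0<..}. ennreal (s powr ?a * norm (?J s *\<^sub>R F s) powr p) \<partial>lborel)
    \<le> ennreal C * (ennreal (2 powr p) * (?E (w + 1) (Suc j) + ennreal ((1 / R) powr p) * ?E (w + 1) j))"
    by (rule order_trans[OF Hardy mult_left_mono[OF v_le]]) simp
  have [measurable]: "(\<lambda>s. ?J s *\<^sub>R F s) \<in> borel_measurable borel"
  proof -
    have "(\<lambda>s. ?J s *\<^sub>R F s) = (\<lambda>s. (1 - s / R) *\<^sub>R (?J s *\<^sub>R G t j s))"
      by (simp add: F_def mult.commute)
    also have "\<dots> \<in> borel_measurable borel"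
      by (intro borel_measurable_scaleR measurable_G) measurable
    finally show ?thesis .
  qed
  have F_meas: "(\<lambda>s. ennreal (s powr ?a * norm (?J s *\<^sub>R F s) powr p) * indicator {0<..} s) \<in> borel_measurable lborel"
    by measurable
  have "?E w j \<le> (\<integral>\<^sup>+s. ennreal (2 powr p) * (ennreal (s powr ?a * norm (?J s *\<^sub>R F s) powr p) * indicator {0<..} s +
      ennreal ((1 / R) powr p) * ennreal (s powr (d / 2 - 1 + (w + 1) * p) * norm (?J s *\<^sub>R G t j s) powr p)) \<partial>lborel)"
    unfolding E
  proof (rule nn_integral_mono)
    fix s :: real
    let ?y = "norm (G t j s)"
    show "ennreal (s powr ?a * norm (?J s *\<^sub>R G t j s) powr p) \<le>
      ennreal (2 powr p) * (ennreal (s powr ?a * norm (?J s *\<^sub>R F s) powr p) * indicator {0<..} s +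
      ennreal ((1 / R) powr p) * ennreal (s powr (d / 2 - 1 + (w + 1) * p) * norm (?J s *\<^sub>R G t j s) powr p))"
    proof (cases "s \<in> {0<..<R}")
      case True
      have "norm (F s) = (1 - s / R) * ?y"
        using True by (simp add: F_def)
      then have split: "norm (F s) + (s / R) * ?y = ?y"
        by (simp add: left_diff_distrib)
      have "(norm (F s) + (s / R) * ?y) powr p \<le> 2 powr p * (norm (F s) powr p + ((s / R) * ?y) powr p)"
        using p True by (intro powr_add_le) auto
      then have "?y powr p \<le> 2 powr p * (norm (F s) powr p + ((s / R) * ?y) powr p)"
        unfolding split .
      also have "((s / R) * ?y) powr p = (1 / R) powr p * (s powr p * ?y powr p)"
        by (simp add: powr_mult powr_divide)
      finally have "s powr ?a * ?y powr p \<le>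
        s powr ?a * (2 powr p * (norm (F s) powr p + (1 / R) powr p * (s powr p * ?y powr p)))"
        by (rule mult_left_mono) simp
      also have "\<dots> = 2 powr p * (s powr ?a * norm (F s) powr p + (1 / R) powr p * (s powr (?a + p) * ?y powr p))"
        unfolding powr_add[of s ?a p] by (simp only: distrib_left mult_ac)
      also have "?a + p = d / 2 - 1 + (w + 1) * p" by (simp add: algebra_simps)
      finally have "ennreal (s powr ?a * ?y powr p) \<le>
        ennreal (2 powr p * (s powr ?a * norm (F s) powr p + (1 / R) powr p * (s powr (d / 2 - 1 + (w + 1) * p) * ?y powr p)))"
        by (rule ennreal_leI)
      also have "\<dots> = ennreal (2 powr p) * (ennreal (s powr ?a * norm (F s) powr p) +
        ennreal ((1 / R) powr p) * ennreal (s powr (d / 2 - 1 + (w + 1) * p) * ?y powr p))"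
        by (simp add: ennreal_mult[symmetric] ennreal_plus[symmetric] del: ennreal_plus)
      finally show ?thesis using True by simp
    qed simp
  qed
  also have "\<dots> = ennreal (2 powr p) * ((\<integral>\<^sup>+s\<in>{0<..}. ennreal (s powr ?a * norm (?J s *\<^sub>R F s) powr p) \<partial>lborel)
      + ennreal ((1 / R) powr p) * ?E (w + 1) j)"
    unfolding E by (rule nn_integral_linear[OF F_meas meas])
  also have "\<dots> \<le> ennreal (2 powr p) * (ennreal C * (ennreal (2 powr p) * (?E (w + 1) (Suc j) + ennreal ((1 / R) powr p) * ?E (w + 1) j))
      + ennreal ((1 / R) powr p) * ?E (w + 1) j)"
    by (intro mult_left_mono add_right_mono F) simp
  also have "\<dots> \<le> ennreal K * (?E (w + 1) j + ?E (w + 1) (Suc j))"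
  proof -
    define S where "S = ?E (w + 1) j + ?E (w + 1) (Suc j)"
    let ?q = "ennreal ((1 / R) powr p)"
    have S: "?E (w + 1) (Suc j) \<le> S" "?E (w + 1) j \<le> S"
      by (simp_all add: S_def add_increasing add_increasing2)
    have q: "?q * ?E (w + 1) j \<le> ?q * S"
      by (rule mult_left_mono[OF S(2)]) simp
    have "ennreal (2 powr p) * (ennreal C * (ennreal (2 powr p) * (?E (w + 1) (Suc j) + ?q * ?E (w + 1) j)) + ?q * ?E (w + 1) j)
      \<le> ennreal (2 powr p) * (ennreal C * (ennreal (2 powr p) * (S + ?q * S)) + ?q * S)"
      by (intro mult_left_mono add_mono S q) simp_all
    also have "\<dots> = (ennreal (2 powr p) * (ennreal C * ennreal (2 powr p) * (1 + ?q) + ?q)) * S"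
      by (simp add: algebra_simps)
    also have "ennreal (2 powr p) * (ennreal C * ennreal (2 powr p) * (1 + ?q) + ?q) = ennreal K"
      by (simp add: K_def C_def ennreal_mult ennreal_plus)
    finally show ?thesis by (simp add: S_def)
  qed
  finally show "?E w j \<le> ennreal K * (?E (w + 1) j + ?E (w + 1) (Suc j))" .
qed

text \<open>
  On a bounded interval a higher power of \<open>s\<close> is a weaker weight.
\<close>

lemma radial_energy_weight_dominated:
  assumes p: "1 \<le> p" and w: "w \<le> w'" and R: "0 < R"
    and u: "\<And>t. t \<in> X \<Longrightarrow> (\<lambda>s. indicator {0<..<R} s *\<^sub>R u t s) \<in> borel_measurable borel"
  shows "dominated_on X (\<lambda>t. radial_energy {0<..<R} p d w' (u t)) (\<lambda>t. radial_energy {0<..<R} p d w (u t))"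
proof (rule dominated_onI)
  show "0 \<le> (R powr (w' - w)) powr p" by simp
  fix t assume t: "t \<in> X"
  let ?f = "\<lambda>s. s powr (d / 2 - 1) * (s powr w * norm (u t s)) powr p"
  have "radial_energy {0<..<R} p d w' (u t) \<le> (\<integral>\<^sup>+s. ennreal ((R powr (w' - w)) powr p) *
    (ennreal (?f s) * indicator {0<..<R} s) \<partial>lborel)"
    unfolding radial_energy_def
  proof (rule nn_integral_mono)
    fix s :: real
    have "s powr (d / 2 - 1) * (s powr w' * norm (u t s)) powr p \<le> (R powr (w' - w)) powr p * ?f s"
      if s: "0 < s" "s < R"
    proof -
      have "s powr w' = s powr (w' - w) * s powr w" by (simp flip: powr_add)
      also have "\<dots> \<le> R powr (w' - w) * s powr w"
        using s w by (intro mult_right_mono powr_mono2) auto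
      finally have "(s powr w' * norm (u t s)) powr p \<le> (R powr (w' - w) * s powr w * norm (u t s)) powr p"
        using p by (intro powr_mono2 mult_right_mono) auto
      also have "\<dots> = (R powr (w' - w)) powr p * (s powr w * norm (u t s)) powr p"
        unfolding mult.assoc by (rule powr_mult)
      finally have "s powr (d / 2 - 1) * (s powr w' * norm (u t s)) powr p
        \<le> s powr (d / 2 - 1) * ((R powr (w' - w)) powr p * (s powr w * norm (u t s)) powr p)"
        by (rule mult_left_mono) simp
      then show ?thesis by (simp only: mult.left_commute)
    qed
    then show "ennreal (s powr (d / 2 - 1) * (s powr w' * norm (u t s)) powr p) * indicator {0<..<R} s \<le>
      ennreal ((R powr (w' - w)) powr p) * (ennreal (?f s) * indicator {0<..<R} s)"
      by (auto simp: indicator_def ennreal_mult[symmetric] intro!: ennreal_leI)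
  qed
  also have "\<dots> = ennreal ((R powr (w' - w)) powr p) * radial_energy {0<..<R} p d w (u t)"
    unfolding radial_energy_def
  proof (rule nn_integral_cmult)
    note u[OF t, measurable]
    have "(\<lambda>s. ennreal (?f s) * indicator {0<..<R} s) =
      (\<lambda>s. ennreal (s powr (d / 2 - 1) * (s powr w * norm (indicator {0<..<R} s *\<^sub>R u t s)) powr p))"
      by (auto simp: indicator_def)
    also have "\<dots> \<in> borel_measurable lborel" by measurable
    finally show "(\<lambda>s. ennreal (?f s) * indicator {0<..<R} s) \<in> borel_measurable lborel" .
  qed
  finally show "radial_energy {0<..<R} p d w' (u t) \<le> ennreal ((R powr (w' - w)) powr p) * radial_energy {0<..<R} p d w (u t)" .
qed

text \<open>
  Each step raises the weight by one and either keeps or raises the order. After \<open>n\<close> steps the weight is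
  \<open>m / 2\<close>, and the orders lie between \<open>j\<close> and \<open>j + n\<close>.
\<close>

lemma Hardy_chain_bounded:
  fixes U :: "(real^'n::finite) set"
  assumes p: "1 \<le> p" and d: "0 < d" and R: "0 < R"
    and jet: "\<And>t. t \<in> X \<Longrightarrow> radial_jet {0<..<R} U (\<Phi> t) (G t)"
    and cont: "\<And>t j. t \<in> X \<Longrightarrow> continuous_on {0<..R} (G t j)"
  shows "j + n \<le> m \<Longrightarrow> 2 * n \<le> m \<Longrightarrow>
    dominated_on X (\<lambda>t. radial_energy {0<..<R} p d (real m / 2 - real n) (G t j))
      (\<lambda>t. \<Sum>i\<le>m. radial_energy {0<..<R} p d (real m / 2) (G t i))"
proof (induction n arbitrary: j)
  case 0
  then show ?case
    using dominated_on_member[of "{..m}" j X "\<lambda>i t. radial_energy {0<..<R} p d (real m / 2) (G t i)"] by simp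
next
  case (Suc n)
  let ?w = "real m / 2 - real (Suc n)"
  have "0 \<le> ?w" using Suc.prems by simp
  then have "dominated_on X (\<lambda>t. radial_energy {0<..<R} p d ?w (G t j))
    (\<lambda>t. radial_energy {0<..<R} p d (?w + 1) (G t j) + radial_energy {0<..<R} p d (?w + 1) (G t (Suc j)))"
    by (intro radial_energy_dominated_by_derivative_bounded[OF p d _ R jet cont])
  also have "dominated_on X
      (\<lambda>t. radial_energy {0<..<R} p d (?w + 1) (G t j) + radial_energy {0<..<R} p d (?w + 1) (G t (Suc j)))
      (\<lambda>t. \<Sum>i\<le>m. radial_energy {0<..<R} p d (real m / 2) (G t i))"
  proof -
    have "?w + 1 = real m / 2 - real n" by simp
    then have "dominated_on X (\<lambda>t. radial_energy {0<..<R} p d (?w + 1) (G t i))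
      (\<lambda>t. \<Sum>i\<le>m. radial_energy {0<..<R} p d (real m / 2) (G t i))" if "i \<in> {j, Suc j}" for i
      using Suc.IH[of i] Suc.prems that by auto
    from dominated_on_sum[OF _ this, of "{j, Suc j}"] show ?thesis by simp
  qed
  finally show ?case .
qed

lemma Hardy_chain_unbounded:
  fixes U :: "(real^'n::finite) set"
  assumes p: "1 \<le> p" and d: "0 < d"
    and jet: "\<And>t. t \<in> X \<Longrightarrow> radial_jet {0<..} U (\<Phi> t) (G t)"
    and vanish: "\<And>t. t \<in> X \<Longrightarrow> \<exists>b. \<forall>j s. b \<le> s \<longrightarrow> G t j s = 0"
  shows "j + n = m \<Longrightarrow> 2 * n \<le> m \<Longrightarrow>
    dominated_on X (\<lambda>t. radial_energy {0<..} p d (real m / 2 - real n) (G t j))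
      (\<lambda>t. radial_energy {0<..} p d (real m / 2) (G t m))"
proof (induction n arbitrary: j)
  case 0
  then show ?case by (simp add: dominated_on_mono)
next
  case (Suc n)
  let ?w = "real m / 2 - real (Suc n)"
  have "0 \<le> ?w" using Suc.prems by simp
  then have "dominated_on X (\<lambda>t. radial_energy {0<..} p d ?w (G t j))
    (\<lambda>t. radial_energy {0<..} p d (?w + 1) (G t (Suc j)))"
    by (intro radial_energy_dominated_by_derivative[OF p d _ jet vanish])
  also have "?w + 1 = real m / 2 - real n" by simp
  also have "dominated_on X (\<lambda>t. radial_energy {0<..} p d (real m / 2 - real n) (G t (Suc j)))
      (\<lambda>t. radial_energy {0<..} p d (real m / 2) (G t m))"
    using Suc.IH[of "Suc j"] Suc.prems by simp
  finally show ?case .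
qed

section \<open>The norms in terms of the energies\<close>

lemma ideriv_0 [simp]: "ideriv I 0 g = g"
  by (simp add: ideriv_def)

lemma ideriv_Suc: "ideriv I (Suc n) g x = vector_derivative (ideriv I n g) (at x within I)"
  by (simp add: ideriv_def)

lemma continuous_on_ideriv: "g \<in> Cinf_on I \<Longrightarrow> continuous_on I (ideriv I j g)"
  by (simp add: Cinf_on_def differentiable_imp_continuous_on)

lemma radial_jet_ideriv:
  assumes g: "g \<in> Cinf_on I" and J: "open J" "J \<subseteq> {0<..}" "J \<subseteq> I"
    and U: "U - {0} = {x. (norm x)\<^sup>2 \<in> J}"
    and \<phi>: "\<And>x. x \<in> U - {0} \<Longrightarrow> \<phi> x = g ((norm x)\<^sup>2)"
  shows "radial_jet J U \<phi> (\<lambda>j. ideriv I j g)"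
proof
  fix j s assume s: "s \<in> J"
  have at: "at s within I = at s"
    using at_within_open_subset[OF s J(1,3)] .
  have "ideriv I j g differentiable at s within I"
    using g s J(3) by (auto simp: Cinf_on_def differentiable_on_def)
  then show "(ideriv I j g has_vector_derivative ideriv I (Suc j) g s) (at s)"
    unfolding ideriv_Suc at by (simp add: vector_derivative_works)
qed (use J U \<phi> in auto)

context radial_jet
begin

text \<open>
  One application of \<open>D\<close> to \<open>\<rho> \<mapsto> G j (\<rho>\<^sup>2)\<close> gives \<open>2 * G (j + 1) (\<rho>\<^sup>2)\<close>. The induction stays in the
  open set \<open>K\<close>, where derivatives relative to \<open>I\<close> are ordinary derivatives.
\<close>

lemma D_op_funpow_eq:
  assumes K: "open K" "K \<subseteq> I" "K \<subseteq> {0<..}"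
    and f: "\<And>\<rho>. \<rho> \<in> K \<Longrightarrow> \<rho>\<^sup>2 \<in> J \<and> f \<rho> = G 0 (\<rho>\<^sup>2)"
  shows "\<rho> \<in> K \<Longrightarrow> (D_op I ^^ j) f \<rho> = 2 ^ j * G j (\<rho>\<^sup>2)"
proof (induction j arbitrary: \<rho>)
  case 0
  then show ?case using f by simp
next
  case (Suc j)
  have at: "at \<rho> within I = at \<rho>" using at_within_open_subset[OF Suc.prems K(1,2)] .
  have "((\<lambda>\<rho>. \<rho>\<^sup>2) has_real_derivative 2 * \<rho>) (at \<rho>)"
    by (auto intro!: derivative_eq_intros)
  then have "((G j \<circ> (\<lambda>\<rho>. \<rho>\<^sup>2)) has_vector_derivative (2 * \<rho>) *\<^sub>R G (Suc j) (\<rho>\<^sup>2)) (at \<rho>)"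
    using f[OF Suc.prems] G by (intro vector_diff_chain_at) (auto simp: has_real_derivative_iff_has_vector_derivative)
  then have "((\<lambda>\<rho>. 2 ^ j * G j (\<rho>\<^sup>2)) has_vector_derivative 2 ^ j * ((2 * \<rho>) *\<^sub>R G (Suc j) (\<rho>\<^sup>2))) (at \<rho>)"
    by (intro has_vector_derivative_mult_right) (simp add: o_def)
  then have "((D_op I ^^ j) f has_vector_derivative 2 ^ j * ((2 * \<rho>) *\<^sub>R G (Suc j) (\<rho>\<^sup>2))) (at \<rho>)"
    by (rule has_vector_derivative_transform_within_open[OF _ K(1) Suc.prems]) (simp add: Suc.IH)
  then have "ideriv I 1 ((D_op I ^^ j) f) \<rho> = 2 ^ j * ((2 * \<rho>) *\<^sub>R G (Suc j) (\<rho>\<^sup>2))"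
    using at by (simp add: ideriv_Suc vector_derivative_at)
  moreover have "\<rho> \<noteq> 0" using Suc.prems K(3) by auto
  moreover from this have "(D_op I ^^ Suc j) f \<rho> = ideriv I 1 ((D_op I ^^ j) f) \<rho> /\<^sub>R \<rho>"
    by (simp add: D_op_def[of I "(D_op I ^^ j) f"])
  ultimately show ?case
    by (simp add: scaleR_conv_of_real)
qed

lemma Lp_norm_D_op:
  fixes d :: real
  defines "d \<equiv> real CARD('n)"
  assumes K: "K = {\<rho>. 0 < \<rho> \<and> \<rho>\<^sup>2 \<in> J}" "K \<subseteq> I" and p: "1 \<le> p"
    and f: "\<And>\<rho>. \<rho> \<in> K \<Longrightarrow> f \<rho> = G 0 (\<rho>\<^sup>2)"
  shows "Lp_norm p K (\<lambda>\<rho>. \<rho> powr ((d - 1) / p + real j) *\<^sub>R (D_op I ^^ j) f \<rho>)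
    = epowr (ennreal ((2 ^ j) powr p / 2) * radial_energy J p d (real j / 2) (G j)) (1 / p)"
proof -
  have open_K: "open K"
  proof -
    have "K = {0<..} \<inter> (\<lambda>\<rho>. \<rho>\<^sup>2) -` J" using K(1) by auto
    then show ?thesis by (auto intro!: open_Int open_vimage J continuous_intros)
  qed
  have D: "(D_op I ^^ j) f \<rho> = 2 ^ j * G j (\<rho>\<^sup>2)" if "\<rho> \<in> K" for \<rho>
    by (rule D_op_funpow_eq[OF open_K K(2)]) (use K(1) f that in auto)
  have "norm (\<rho> powr ((d - 1) / p + real j) *\<^sub>R (D_op I ^^ j) f \<rho>) powr p =
     (2 ^ j) powr p * (\<rho> powr (d - 1) * ((\<rho>\<^sup>2) powr (real j / 2) * norm (G j (\<rho>\<^sup>2))) powr p)" if \<rho>: "\<rho> \<in> K" for \<rho>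
  proof -
    have "0 < \<rho>" using \<rho> K(1) by auto
    then have "(\<rho>\<^sup>2) powr (real j / 2) = \<rho> powr real j"
      by (simp add: powr_powr flip: powr_numeral)
    moreover have "(\<rho> powr ((d - 1) / p + real j)) powr p = \<rho> powr (d - 1) * (\<rho> powr real j) powr p"
    proof -
      have "((d - 1) / p + real j) * p = (d - 1) + real j * p" using p by (simp add: field_simps)
      then show ?thesis unfolding powr_powr powr_add[symmetric] by (rule arg_cong)
    qed
    ultimately show ?thesis
      unfolding D[OF \<rho>] norm_scaleR norm_mult norm_power abs_of_nonneg[OF powr_ge_zero] powr_mult
      by (simp add: mult_ac del: powr_powr)
  qed
  then have "(\<integral>\<^sup>+\<rho>\<in>K. ennreal (norm (\<rho> powr ((d - 1) / p + real j) *\<^sub>R (D_op I ^^ j) f \<rho>) powr p) \<partial>lborel)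
    = (\<integral>\<^sup>+\<rho>. ennreal ((2 ^ j) powr p) * (ennreal (\<rho> powr (d - 1) * ((\<rho>\<^sup>2) powr (real j / 2) * norm (G j (\<rho>\<^sup>2))) powr p)
        * indicator K \<rho>) \<partial>lborel)"
    by (intro nn_integral_cong) (simp add: ennreal_mult indicator_def)
  also have "\<dots> = ennreal ((2 ^ j) powr p) * (ennreal (1 / 2) * radial_energy J p d (real j / 2) (G j))"
    unfolding integral_profile[symmetric] d_def K(1)[symmetric]
  proof (rule nn_integral_cmult)
    have "(\<lambda>\<rho>. ennreal (\<rho> powr (real CARD('n) - 1) * ((\<rho>\<^sup>2) powr (real j / 2) * norm (G j (\<rho>\<^sup>2))) powr p) * indicator K \<rho>)
      = (\<lambda>\<rho>. ennreal (\<rho> powr (real CARD('n) - 1)) * indicator {0<..} \<rho> *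
          (\<lambda>s. ennreal ((s powr (real j / 2) * norm (G j s)) powr p) * indicator J s) (\<rho>\<^sup>2))"
      by (auto simp: K(1) indicator_def ennreal_mult)
    also have "\<dots> \<in> borel_measurable lborel"
      using measurable_compose[OF _ measurable_weighted_G, of "\<lambda>\<rho>. \<rho>\<^sup>2" borel] by measurable
    finally show "(\<lambda>\<rho>. ennreal (\<rho> powr (real CARD('n) - 1) * ((\<rho>\<^sup>2) powr (real j / 2) * norm (G j (\<rho>\<^sup>2))) powr p) * indicator K \<rho>)
      \<in> borel_measurable lborel" .
  qed
  also have "\<dots> = ennreal ((2 ^ j) powr p / 2) * radial_energy J p d (real j / 2) (G j)"
    unfolding mult.assoc[symmetric] by (subst ennreal_mult[symmetric]) simp_all
  finally show ?thesis
    unfolding Lp_norm_def by (rule arg_cong)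
qed

lemma Lp_norm_G:
  assumes p: "1 \<le> p"
  shows "Lp_norm p J (\<lambda>s. s powr ((d - 2) / (2 * p) + real j / 2) *\<^sub>R G j s)
    = epowr (radial_energy J p d (real j / 2) (G j)) (1 / p)"
proof -
  have "norm (s powr ((d - 2) / (2 * p) + real j / 2) *\<^sub>R G j s) powr p =
    s powr (d / 2 - 1) * (s powr (real j / 2) * norm (G j s)) powr p" for s
  proof -
    have "((d - 2) / (2 * p) + real j / 2) * p = (d / 2 - 1) + real j / 2 * p"
      using p by (simp add: field_simps)
    then have "(s powr ((d - 2) / (2 * p) + real j / 2)) powr p = s powr (d / 2 - 1) * (s powr (real j / 2)) powr p"
      unfolding powr_powr powr_add[symmetric] by (rule arg_cong)
    then show ?thesis
      unfolding norm_scaleR abs_of_nonneg[OF powr_ge_zero] powr_mult by (simp only: mult.assoc)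
  qed
  then show ?thesis unfolding Lp_norm_def radial_energy_def by simp
qed

end

text \<open>
  Two finite families of energies that dominate each other yield equivalent norms; the constants \<open>c j\<close>
  account for the factor \<open>2 ^ j\<close> in \<open>D\<^sup>j f\<close> and for the substitution \<open>s = \<rho>\<^sup>2\<close>.
\<close>

lemma equivalent_on_norms:
  fixes X :: "'t set" and c :: "'j \<Rightarrow> real"
  assumes p: "1 \<le> p" and fin: "finite A" "finite B" and c: "\<And>j. j \<in> B \<Longrightarrow> 0 < c j"
    and upper: "\<And>i. i \<in> A \<Longrightarrow> dominated_on X (E i) (\<lambda>t. \<Sum>j\<in>B. F j t)"
    and lower: "\<And>j. j \<in> B \<Longrightarrow> dominated_on X (F j) (\<lambda>t. \<Sum>i\<in>A. E i t)"
  shows "equivalent_on X (\<lambda>t. epowr (\<Sum>i\<in>A. E i t) (1 / p)) (\<lambda>t. \<Sum>j\<in>B. epowr (ennreal (c j) * F j t) (1 / p))"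
    and "equivalent_on X (\<lambda>t. \<Sum>j\<in>B. epowr (ennreal (c j) * F j t) (1 / p)) (\<lambda>t. \<Sum>j\<in>B. epowr (F j t) (1 / p))"
proof -
  let ?F = "\<lambda>j t. ennreal (c j) * F j t"
  have p': "0 < 1 / p" using p by simp
  have cF: "dominated_on X (?F j) (F j)" and Fc: "dominated_on X (F j) (?F j)" if "j \<in> B" for j
  proof -
    show "dominated_on X (?F j) (F j)"
      by (rule dominated_onI[of "c j"]) (use c[OF that] in auto)
    show "dominated_on X (F j) (?F j)"
      by (rule dominated_onI[of "1 / c j"])
         (use c[OF that] in \<open>simp_all add: mult.assoc[symmetric] ennreal_mult[symmetric]\<close>)
  qed
  have "dominated_on X (\<lambda>t. \<Sum>i\<in>A. E i t) (\<lambda>t. \<Sum>j\<in>B. ?F j t)"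
  proof (rule dominated_on_sum[OF fin(1)])
    fix i assume "i \<in> A"
    then have "dominated_on X (E i) (\<lambda>t. \<Sum>j\<in>B. F j t)" by (rule upper)
    also have "dominated_on X (\<lambda>t. \<Sum>j\<in>B. F j t) (\<lambda>t. \<Sum>j\<in>B. ?F j t)"
      by (rule dominated_on_sum[OF fin(2)], rule dominated_on_trans[OF Fc dominated_on_member[OF fin(2)]])
    finally show "dominated_on X (E i) (\<lambda>t. \<Sum>j\<in>B. ?F j t)" .
  qed
  then have "dominated_on X (\<lambda>t. epowr (\<Sum>i\<in>A. E i t) (1 / p)) (\<lambda>t. epowr (\<Sum>j\<in>B. ?F j t) (1 / p))"
    using p' by (intro dominated_on_epowr) auto
  also have "dominated_on X (\<lambda>t. epowr (\<Sum>j\<in>B. ?F j t) (1 / p)) (\<lambda>t. \<Sum>j\<in>B. epowr (?F j t) (1 / p))"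
    by (rule dominated_on_epowr_sum[OF fin(2) p'])
  finally have 1: "dominated_on X (\<lambda>t. epowr (\<Sum>i\<in>A. E i t) (1 / p)) (\<lambda>t. \<Sum>j\<in>B. epowr (?F j t) (1 / p))" .
  have "dominated_on X (\<lambda>t. \<Sum>j\<in>B. ?F j t) (\<lambda>t. \<Sum>i\<in>A. E i t)"
    by (rule dominated_on_sum[OF fin(2)], rule dominated_on_trans[OF cF lower])
  then have "dominated_on X (\<lambda>t. epowr (\<Sum>j\<in>B. ?F j t) (1 / p)) (\<lambda>t. epowr (\<Sum>i\<in>A. E i t) (1 / p))"
    using p' by (intro dominated_on_epowr) auto
  with dominated_on_sum_epowr[OF fin(2) p']
  have 2: "dominated_on X (\<lambda>t. \<Sum>j\<in>B. epowr (?F j t) (1 / p)) (\<lambda>t. epowr (\<Sum>i\<in>A. E i t) (1 / p))"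
    by (rule dominated_on_trans)
  show "equivalent_on X (\<lambda>t. epowr (\<Sum>i\<in>A. E i t) (1 / p)) (\<lambda>t. \<Sum>j\<in>B. epowr (?F j t) (1 / p))"
    by (rule equivalent_onI[OF 1 2])
  have sum: "dominated_on X (\<lambda>t. \<Sum>j\<in>B. epowr (F j t) (1 / p)) (\<lambda>t. \<Sum>j\<in>B. epowr (H j t) (1 / p))"
    if "\<And>j. j \<in> B \<Longrightarrow> dominated_on X (F j) (H j)" for F H :: "'j \<Rightarrow> 't \<Rightarrow> ennreal"
  proof (rule dominated_on_sum[OF fin(2)])
    fix j assume j: "j \<in> B"
    have "dominated_on X (\<lambda>t. epowr (F j t) (1 / p)) (\<lambda>t. epowr (H j t) (1 / p))"
      using p' that[OF j] by (intro dominated_on_epowr) auto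
    also have "dominated_on X (\<lambda>t. epowr (H j t) (1 / p)) (\<lambda>t. \<Sum>j\<in>B. epowr (H j t) (1 / p))"
      by (rule dominated_on_member[OF fin(2) j])
    finally show "dominated_on X (\<lambda>t. epowr (F j t) (1 / p)) (\<lambda>t. \<Sum>j\<in>B. epowr (H j t) (1 / p))" .
  qed
  show "equivalent_on X (\<lambda>t. \<Sum>j\<in>B. epowr (?F j t) (1 / p)) (\<lambda>t. \<Sum>j\<in>B. epowr (F j t) (1 / p))"
    by (rule equivalent_onI[OF sum[OF cF] sum[OF Fc]])
qed

lemma equivalent_on_cong:
  assumes "equivalent_on X A B" "\<And>x. x \<in> X \<Longrightarrow> A x = A' x" "\<And>x. x \<in> X \<Longrightarrow> B x = B' x"
  shows "equivalent_on X A' B'"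
  using assms unfolding equivalent_on_def by simp

lemma W_norm_eq:
  assumes "1 \<le> p"
  shows "W_norm k p U \<phi> = epowr (\<Sum>\<alpha> | (\<Sum>i\<in>UNIV. \<alpha> i) \<le> k.
    \<integral>\<^sup>+x\<in>U. ennreal (norm (mderiv \<alpha> \<phi> x) powr p) \<partial>lborel) (1 / p)"
  using assms by (simp add: W_norm_def Lp_norm_def epowr_epowr)

lemma W_hom_norm_eq:
  assumes "1 \<le> p"
  shows "W_hom_norm k p \<phi> = epowr (\<Sum>\<alpha> | (\<Sum>i\<in>UNIV. \<alpha> i) = k.
    \<integral>\<^sup>+x\<in>UNIV. ennreal (norm (mderiv \<alpha> \<phi> x) powr p) \<partial>lborel) (1 / p)"
  using assms by (simp add: W_hom_norm_def Lp_norm_def epowr_epowr)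

lemma radial_jet_ball:
  assumes "(\<phi>, f, g) \<in> radial_profiles_ball r" "0 < r"
  shows "radial_jet {0<..<r\<^sup>2} (ball 0 r) \<phi> (\<lambda>j. ideriv {0..r\<^sup>2} j g)"
proof (rule radial_jet_ideriv)
  show "ball 0 r - {0} = {x::real^'n. (norm x)\<^sup>2 \<in> {0<..<r\<^sup>2}}"
    using assms(2) by (auto simp: power_strict_mono dest: power2_less_imp_less)
  show "\<phi> x = g ((norm x)\<^sup>2)" if "x \<in> ball 0 r - {0}" for x
    using assms(1) that by (auto simp only: radial_profiles_ball_def)
qed (use assms in \<open>auto simp: radial_profiles_ball_def\<close>)

lemma radial_jet_space:
  assumes "(\<phi>, f, g) \<in> radial_profiles_space"
  shows "radial_jet {0<..} UNIV \<phi> (\<lambda>j. ideriv {0..} j g)"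
proof (rule radial_jet_ideriv)
  show "UNIV - {0} = {x::real^'n. (norm x)\<^sup>2 \<in> {0<..}}" by auto
  show "\<phi> x = g ((norm x)\<^sup>2)" for x
    using assms by (auto simp only: radial_profiles_space_def)
qed (use assms in \<open>auto simp: radial_profiles_space_def\<close>)

text \<open>
  The profile vanishes beyond the square of a radius containing the support, and so do its derivatives.
\<close>

lemma ideriv_eventually_0:
  fixes \<phi> :: "real^'n::finite \<Rightarrow> complex"
  assumes t: "(\<phi>, f, g) \<in> radial_profiles_space"
  shows "\<exists>b. \<forall>j s. b \<le> s \<longrightarrow> ideriv {0..} j g s = 0"
proof -
  have "\<phi> \<in> Cinf_c" using t by (auto simp: radial_profiles_space_def)
  then have "compact (closure {x. \<phi> x \<noteq> 0})"
    by (simp add: Cinf_c_def)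
  then have "bounded {x. \<phi> x \<noteq> 0}"
    using bounded_subset[OF compact_imp_bounded closure_subset] by blast
  then obtain B where B: "\<And>x. \<phi> x \<noteq> 0 \<Longrightarrow> norm x \<le> B" by (auto simp: bounded_iff)
  \<comment> \<open>The maximum covers the case \<open>B < 0\<close>, in which \<open>\<phi>\<close> vanishes identically.\<close>
  define b where "b = (max B 0)\<^sup>2"
  have g0: "g s = 0" if "b < s" for s
  proof -
    have "0 \<le> b" by (simp add: b_def)
    then have "0 \<le> sqrt s" using that by simp
    then obtain x :: "real^'n" where x: "norm x = sqrt s"
      by (rule vector_choose_size)
    have "max B 0 < sqrt s" using that by (intro real_less_rsqrt) (simp add: b_def)
    then have "\<phi> x = 0" using B[of x] x by auto
    moreover have "\<phi> x = g ((norm x)\<^sup>2)" using t by (auto simp only: radial_profiles_space_def)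
    ultimately show ?thesis using x that \<open>0 \<le> b\<close> by simp
  qed
  have "ideriv {0..} j g s = 0" if "b < s" for j s
    using that
  proof (induction j arbitrary: s)
    case 0
    then show ?case by (simp add: g0)
  next
    case (Suc j)
    have "at s within {0..} = at s"
      by (rule at_within_open_subset[of s "{b<..}"]) (use Suc.prems in \<open>auto simp: b_def intro: order_trans[OF zero_le_power2 less_imp_le]\<close>)
    moreover have "(ideriv {0..} j g has_vector_derivative 0) (at s)"
      by (rule has_vector_derivative_transform_within_open[of "\<lambda>_. 0" 0 s "{b<..}"]) (use Suc in auto)
    ultimately show ?case by (simp add: ideriv_Suc vector_derivative_at)
  qed
  then have "\<forall>j s. b + 1 \<le> s \<longrightarrow> ideriv {0..} j g s = 0" by simp
  then show ?thesis ..
qed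

section \<open>Equivalence of the norms\<close>

lemma energies_ball:
  fixes X :: "((real^'n::finite \<Rightarrow> complex) \<times> (real \<Rightarrow> complex) \<times> (real \<Rightarrow> complex)) set"
    and p r :: real and k :: nat
  defines "X \<equiv> radial_profiles_ball r"
    and "E \<equiv> \<lambda>\<alpha> (t :: (real^'n \<Rightarrow> complex) \<times> (real \<Rightarrow> complex) \<times> (real \<Rightarrow> complex)).
      \<integral>\<^sup>+x\<in>ball 0 r. ennreal (norm (mderiv \<alpha> (fst t) x) powr p) \<partial>lborel"
    and "F \<equiv> \<lambda>j (t :: (real^'n \<Rightarrow> complex) \<times> (real \<Rightarrow> complex) \<times> (real \<Rightarrow> complex)).
      radial_energy {0<..<r\<^sup>2} p CARD('n) (real j / 2) (ideriv {0..r\<^sup>2} j (snd (snd t)))"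
  assumes n: "2 \<le> CARD('n)" and p: "1 \<le> p" and r: "0 < r"
  shows "(\<Sum>i\<in>UNIV. \<alpha> i) \<le> k \<Longrightarrow> dominated_on X (E \<alpha>) (\<lambda>t. \<Sum>j=0..k. F j t)"
    and "j \<in> {0..k} \<Longrightarrow> dominated_on X (F j) (\<lambda>t. \<Sum>\<alpha> | (\<Sum>i\<in>UNIV. \<alpha> i) \<le> k. E \<alpha> t)"
proof -
  let ?G = "\<lambda>t j. ideriv {0..r\<^sup>2} j (snd (snd t))"
  let ?d = "real CARD('n)"
  have jet: "radial_jet {0<..<r\<^sup>2} (ball 0 r) (fst t) (?G t)" if "t \<in> X" for t
    using radial_jet_ball[of "fst t" "fst (snd t)" "snd (snd t)"] that r by (simp add: X_def)
  have cont: "continuous_on {0<..r\<^sup>2} (?G t j)" if "t \<in> X" for t j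
  proof -
    have "snd (snd t) \<in> Cinf_on {0..r\<^sup>2}" using that by (auto simp: X_def radial_profiles_ball_def)
    then show ?thesis by (rule continuous_on_subset[OF continuous_on_ideriv]) auto
  qed
  have d: "0 < ?d" and R: "0 < r\<^sup>2" using n r by auto
  {
    assume k: "(\<Sum>i\<in>UNIV. \<alpha> i) \<le> k"
    define m where "m = (\<Sum>i\<in>UNIV. \<alpha> i)"
    have "dominated_on X (E \<alpha>) (\<lambda>t. \<Sum>j | j \<le> m \<and> m \<le> 2 * j.
        radial_energy {0<..<r\<^sup>2} p ?d (real j - m / 2) (?G t j))"
      unfolding E_def m_def by (rule mderiv_dominated[OF p jet])
    also have "dominated_on X (\<lambda>t. \<Sum>j | j \<le> m \<and> m \<le> 2 * j.
        radial_energy {0<..<r\<^sup>2} p ?d (real j - m / 2) (?G t j))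
        (\<lambda>t. \<Sum>i\<le>m. radial_energy {0<..<r\<^sup>2} p ?d (real m / 2) (?G t i))"
    proof (rule dominated_on_sum)
      show "finite {j. j \<le> m \<and> m \<le> 2 * j}" by (rule finite_subset[of _ "{..m}"]) auto
      fix j assume j: "j \<in> {j. j \<le> m \<and> m \<le> 2 * j}"
      have "real m / 2 - real (m - j) = real j - m / 2" using j by (simp add: of_nat_diff)
      then show "dominated_on X (\<lambda>t. radial_energy {0<..<r\<^sup>2} p ?d (real j - m / 2) (?G t j))
        (\<lambda>t. \<Sum>i\<le>m. radial_energy {0<..<r\<^sup>2} p ?d (real m / 2) (?G t i))"
        using Hardy_chain_bounded[OF p d R jet cont, where j = j and n = "m - j" and m = m] j by auto
    qed
    also have "dominated_on X (\<lambda>t. \<Sum>i\<le>m. radial_energy {0<..<r\<^sup>2} p ?d (real m / 2) (?G t i)) (\<lambda>t. \<Sum>j=0..k. F j t)"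
    proof (rule dominated_on_sum)
      fix i assume i: "i \<in> {..m}"
      have "dominated_on X (\<lambda>t. radial_energy {0<..<r\<^sup>2} p ?d (real m / 2) (?G t i)) (F i)"
        unfolding F_def
        by (rule radial_energy_weight_dominated[OF p _ R radial_jet.measurable_G[OF jet]]) (use i in auto)
      also have "dominated_on X (F i) (\<lambda>t. \<Sum>j=0..k. F j t)"
        by (rule dominated_on_member) (use i k m_def in auto)
      finally show "dominated_on X (\<lambda>t. radial_energy {0<..<r\<^sup>2} p ?d (real m / 2) (?G t i)) (\<lambda>t. \<Sum>j=0..k. F j t)" .
    qed simp
    finally show "dominated_on X (E \<alpha>) (\<lambda>t. \<Sum>j=0..k. F j t)" .
  }
  {
    assume j: "j \<in> {0..k}"
    have "dominated_on X (F j) (\<lambda>t. \<Sum>\<alpha> | (\<Sum>i\<in>UNIV. \<alpha> i) = j. E \<alpha> t)"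
      unfolding F_def E_def by (rule radial_energy_dominated_by_mderiv[OF n p jet])
    also have "dominated_on X (\<lambda>t. \<Sum>\<alpha> | (\<Sum>i\<in>UNIV. \<alpha> i) = j. E \<alpha> t) (\<lambda>t. \<Sum>\<alpha> | (\<Sum>i\<in>UNIV. \<alpha> i) \<le> k. E \<alpha> t)"
      by (rule dominated_on_mono, rule sum_mono2) (use j finite_multi_indices in auto)
    finally show "dominated_on X (F j) (\<lambda>t. \<Sum>\<alpha> | (\<Sum>i\<in>UNIV. \<alpha> i) \<le> k. E \<alpha> t)" .
  }
qed

lemma energies_space:
  fixes X :: "((real^'n::finite \<Rightarrow> complex) \<times> (real \<Rightarrow> complex) \<times> (real \<Rightarrow> complex)) set"
    and p :: real and k :: nat
  defines "X \<equiv> radial_profiles_space"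
    and "E \<equiv> \<lambda>\<alpha> (t :: (real^'n \<Rightarrow> complex) \<times> (real \<Rightarrow> complex) \<times> (real \<Rightarrow> complex)).
      \<integral>\<^sup>+x\<in>UNIV. ennreal (norm (mderiv \<alpha> (fst t) x) powr p) \<partial>lborel"
    and "F \<equiv> \<lambda>t :: (real^'n \<Rightarrow> complex) \<times> (real \<Rightarrow> complex) \<times> (real \<Rightarrow> complex).
      radial_energy {0<..} p CARD('n) (real k / 2) (ideriv {0..} k (snd (snd t)))"
  assumes n: "2 \<le> CARD('n)" and p: "1 \<le> p"
  shows "(\<Sum>i\<in>UNIV. \<alpha> i) = k \<Longrightarrow> dominated_on X (E \<alpha>) F"
    and "dominated_on X F (\<lambda>t. \<Sum>\<alpha> | (\<Sum>i\<in>UNIV. \<alpha> i) = k. E \<alpha> t)"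
proof -
  let ?G = "\<lambda>t j. ideriv {0..} j (snd (snd t))"
  let ?d = "real CARD('n)"
  have jet: "radial_jet {0<..} UNIV (fst t) (?G t)" if "t \<in> X" for t
    using radial_jet_space[of "fst t" "fst (snd t)" "snd (snd t)"] that by (simp add: X_def)
  have vanish: "\<exists>b. \<forall>j s. b \<le> s \<longrightarrow> ?G t j s = 0" if "t \<in> X" for t
    using ideriv_eventually_0[of "fst t" "fst (snd t)" "snd (snd t)"] that by (simp add: X_def)
  have d: "0 < ?d" using n by auto
  {
    assume k: "(\<Sum>i\<in>UNIV. \<alpha> i) = k"
    have "dominated_on X (E \<alpha>) (\<lambda>t. \<Sum>j | j \<le> k \<and> k \<le> 2 * j.
        radial_energy {0<..} p ?d (real j - k / 2) (?G t j))"
      unfolding E_def k[symmetric] by (rule mderiv_dominated[OF p jet])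
    also have "dominated_on X (\<lambda>t. \<Sum>j | j \<le> k \<and> k \<le> 2 * j.
        radial_energy {0<..} p ?d (real j - k / 2) (?G t j)) F"
    proof (rule dominated_on_sum)
      show "finite {j. j \<le> k \<and> k \<le> 2 * j}" by (rule finite_subset[of _ "{..k}"]) auto
      fix j assume j: "j \<in> {j. j \<le> k \<and> k \<le> 2 * j}"
      have "real k / 2 - real (k - j) = real j - k / 2" using j by (simp add: of_nat_diff)
      then show "dominated_on X (\<lambda>t. radial_energy {0<..} p ?d (real j - k / 2) (?G t j)) F"
        unfolding F_def using Hardy_chain_unbounded[OF p d jet vanish, where j = j and n = "k - j" and m = k] j by auto
    qed
    finally show "dominated_on X (E \<alpha>) F" .
  }
  show "dominated_on X F (\<lambda>t. \<Sum>\<alpha> | (\<Sum>i\<in>UNIV. \<alpha> i) = k. E \<alpha> t)"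
    unfolding F_def E_def by (rule radial_energy_dominated_by_mderiv[OF n p jet])
qed

theorem theorem1p1:
  fixes k :: nat and p r :: real
  defines "d \<equiv> real CARD('n::finite)"
  assumes "CARD('n) \<ge> 2" and "p \<ge> 1" and "r > 0"
  shows
    "equivalent_on (radial_profiles_ball r :: ((real^'n \<Rightarrow> complex) \<times> _) set)
       (\<lambda>(\<phi>, f, g). W_norm k p (ball 0 r) \<phi>)
       (\<lambda>(\<phi>, f, g). \<Sum>j=0..k. Lp_norm p {0<..<r}
          (\<lambda>\<rho>. \<rho> powr ((d - 1) / p + real j) *\<^sub>R (D_op {0..r} ^^ j) f \<rho>))
     \<and> equivalent_on (radial_profiles_ball r :: ((real^'n \<Rightarrow> complex) \<times> _) set)
       (\<lambda>(\<phi>, f, g). \<Sum>j=0..k. Lp_norm p {0<..<r}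
          (\<lambda>\<rho>. \<rho> powr ((d - 1) / p + real j) *\<^sub>R (D_op {0..r} ^^ j) f \<rho>))
       (\<lambda>(\<phi>, f, g). \<Sum>j=0..k. Lp_norm p {0<..<r\<^sup>2}
          (\<lambda>s. s powr ((d - 2) / (2 * p) + real j / 2) *\<^sub>R ideriv {0..r\<^sup>2} j g s))
     \<and> equivalent_on (radial_profiles_space :: ((real^'n \<Rightarrow> complex) \<times> _) set)
       (\<lambda>(\<phi>, f, g). W_hom_norm k p \<phi>)
       (\<lambda>(\<phi>, f, g). Lp_norm p {0<..}
          (\<lambda>\<rho>. \<rho> powr ((d - 1) / p + real k) *\<^sub>R (D_op {0..} ^^ k) f \<rho>))
     \<and> equivalent_on (radial_profiles_space :: ((real^'n \<Rightarrow> complex) \<times> _) set)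
       (\<lambda>(\<phi>, f, g). Lp_norm p {0<..}
          (\<lambda>\<rho>. \<rho> powr ((d - 1) / p + real k) *\<^sub>R (D_op {0..} ^^ k) f \<rho>))
       (\<lambda>(\<phi>, f, g). Lp_norm p {0<..}
          (\<lambda>s. s powr ((d - 2) / (2 * p) + real k / 2) *\<^sub>R ideriv {0..} k g s))"
proof -
  note n = assms(2) and p = assms(3) and r = assms(4)
  \<comment> \<open>The factor \<open>1 / 2\<close> comes from \<open>ds = 2 * \<rho> d\<rho>\<close>, and \<open>(2 ^ j) powr p\<close> from \<open>D\<^sup>j\<close>.\<close>
  define c where "c j = (2 ^ j) powr p / 2" for j :: nat
  have c: "0 < c j" for j by (simp add: c_def)
  let ?B = "radial_profiles_ball r :: ((real^'n \<Rightarrow> complex) \<times> (real \<Rightarrow> complex) \<times> (real \<Rightarrow> complex)) set"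
  let ?S = "radial_profiles_space :: ((real^'n \<Rightarrow> complex) \<times> (real \<Rightarrow> complex) \<times> (real \<Rightarrow> complex)) set"
  have ball_D: "Lp_norm p {0<..<r} (\<lambda>\<rho>. \<rho> powr ((d - 1) / p + real j) *\<^sub>R (D_op {0..r} ^^ j) f \<rho>)
      = epowr (ennreal (c j) * radial_energy {0<..<r\<^sup>2} p CARD('n) (real j / 2) (ideriv {0..r\<^sup>2} j g)) (1 / p)"
    if t: "(\<phi>, f, g) \<in> ?B" for \<phi> f g j
    unfolding c_def d_def
  proof (rule radial_jet.Lp_norm_D_op[OF radial_jet_ball[OF t r] _ _ p])
    show "{0<..<r} = {\<rho>. 0 < \<rho> \<and> \<rho>\<^sup>2 \<in> {0<..<r\<^sup>2}}"
      using r by (auto simp: power_strict_mono dest: power2_less_imp_less)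
    show "f \<rho> = ideriv {0..r\<^sup>2} 0 g (\<rho>\<^sup>2)" if \<rho>: "\<rho> \<in> {0<..<r}" for \<rho>
    proof -
      obtain x :: "real^'n" where x: "norm x = \<rho>" using vector_choose_size[of \<rho>] \<rho> by auto
      then have "x \<in> ball 0 r" using \<rho> by simp
      then have "\<phi> x = f (norm x)" "\<phi> x = g ((norm x)\<^sup>2)"
        using t by (auto simp only: radial_profiles_ball_def)
      then show ?thesis using x by simp
    qed
  qed auto
  have space_D: "Lp_norm p {0<..} (\<lambda>\<rho>. \<rho> powr ((d - 1) / p + real j) *\<^sub>R (D_op {0..} ^^ j) f \<rho>)
      = epowr (ennreal (c j) * radial_energy {0<..} p CARD('n) (real j / 2) (ideriv {0..} j g)) (1 / p)"
    if t: "(\<phi>, f, g) \<in> ?S" for \<phi> f g j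
    unfolding c_def d_def
  proof (rule radial_jet.Lp_norm_D_op[OF radial_jet_space[OF t] _ _ p])
    show "f \<rho> = ideriv {0..} 0 g (\<rho>\<^sup>2)" if \<rho>: "\<rho> \<in> {0<..}" for \<rho>
    proof -
      obtain x :: "real^'n" where x: "norm x = \<rho>" using vector_choose_size[of \<rho>] \<rho> by auto
      have "\<phi> x = f (norm x)" "\<phi> x = g ((norm x)\<^sup>2)"
        using t by (auto simp only: radial_profiles_space_def)
      then show ?thesis using x by simp
    qed
  qed auto
  have ball_G: "Lp_norm p {0<..<r\<^sup>2} (\<lambda>s. s powr ((d - 2) / (2 * p) + real j / 2) *\<^sub>R ideriv {0..r\<^sup>2} j g s)
      = epowr (radial_energy {0<..<r\<^sup>2} p CARD('n) (real j / 2) (ideriv {0..r\<^sup>2} j g)) (1 / p)"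
    if t: "(\<phi>, f, g) \<in> ?B" for \<phi> f g j
    unfolding d_def by (rule radial_jet.Lp_norm_G[OF radial_jet_ball[OF t r] p])
  have space_G: "Lp_norm p {0<..} (\<lambda>s. s powr ((d - 2) / (2 * p) + real j / 2) *\<^sub>R ideriv {0..} j g s)
      = epowr (radial_energy {0<..} p CARD('n) (real j / 2) (ideriv {0..} j g)) (1 / p)"
    if t: "(\<phi>, f, g) \<in> ?S" for \<phi> f g j
    unfolding d_def by (rule radial_jet.Lp_norm_G[OF radial_jet_space[OF t] p])
  let ?F = "\<lambda>j t. radial_energy {0<..<r\<^sup>2} p CARD('n) (real j / 2) (ideriv {0..r\<^sup>2} j (snd (snd t)))"
  let ?H = "\<lambda>j t. radial_energy {0<..} p CARD('n) (real j / 2) (ideriv {0..} j (snd (snd t)))"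
  let ?E = "\<lambda>U \<alpha> (t :: (real^'n \<Rightarrow> complex) \<times> (real \<Rightarrow> complex) \<times> (real \<Rightarrow> complex)).
    \<integral>\<^sup>+x\<in>U. ennreal (norm (mderiv \<alpha> (fst t) x) powr p) \<partial>lborel"
  have "dominated_on ?B (?E (ball 0 r) \<alpha>) (\<lambda>t. \<Sum>j=0..k. ?F j t)"
    if "\<alpha> \<in> {\<alpha>. (\<Sum>i\<in>UNIV. \<alpha> i) \<le> k}" for \<alpha>
    using that by (intro energies_ball n p r) simp
  note ball = equivalent_on_norms[where c = c, OF p finite_multi_indices finite_atLeastAtMost c this
      energies_ball(2)[OF n p r]]
  have "dominated_on ?S (?E UNIV \<alpha>) (\<lambda>t. \<Sum>j\<in>{k}. ?H j t)"
    if "\<alpha> \<in> {\<alpha>. (\<Sum>i\<in>UNIV. \<alpha> i) = k}" for \<alpha>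
    using that energies_space(1)[OF n p, of \<alpha> k] by simp
  note space_upper = this
  have "dominated_on ?S (?H j) (\<lambda>t. \<Sum>\<alpha> | (\<Sum>i\<in>UNIV. \<alpha> i) = k. ?E UNIV \<alpha> t)" if "j \<in> {k}" for j
    using that energies_space(2)[OF n p, of k] by simp
  note space = equivalent_on_norms[where c = c, OF p finite_multi_indices_eq
      finite.insertI[OF finite.emptyI] c space_upper this]
  show ?thesis
  proof (intro conjI)
    show "equivalent_on ?B (\<lambda>(\<phi>, f, g). W_norm k p (ball 0 r) \<phi>)
       (\<lambda>(\<phi>, f, g). \<Sum>j=0..k. Lp_norm p {0<..<r}
          (\<lambda>\<rho>. \<rho> powr ((d - 1) / p + real j) *\<^sub>R (D_op {0..r} ^^ j) f \<rho>))"
      by (rule equivalent_on_cong[OF ball(1)]) (auto simp: W_norm_eq[OF p] ball_D)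
    show "equivalent_on ?B
       (\<lambda>(\<phi>, f, g). \<Sum>j=0..k. Lp_norm p {0<..<r}
          (\<lambda>\<rho>. \<rho> powr ((d - 1) / p + real j) *\<^sub>R (D_op {0..r} ^^ j) f \<rho>))
       (\<lambda>(\<phi>, f, g). \<Sum>j=0..k. Lp_norm p {0<..<r\<^sup>2}
          (\<lambda>s. s powr ((d - 2) / (2 * p) + real j / 2) *\<^sub>R ideriv {0..r\<^sup>2} j g s))"
      by (rule equivalent_on_cong[OF ball(2)]) (auto simp: ball_D ball_G)
    show "equivalent_on ?S (\<lambda>(\<phi>, f, g). W_hom_norm k p \<phi>)
       (\<lambda>(\<phi>, f, g). Lp_norm p {0<..}
          (\<lambda>\<rho>. \<rho> powr ((d - 1) / p + real k) *\<^sub>R (D_op {0..} ^^ k) f \<rho>))"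
      by (rule equivalent_on_cong[OF space(1)]) (auto simp: W_hom_norm_eq[OF p] space_D)
    show "equivalent_on ?S
       (\<lambda>(\<phi>, f, g). Lp_norm p {0<..}
          (\<lambda>\<rho>. \<rho> powr ((d - 1) / p + real k) *\<^sub>R (D_op {0..} ^^ k) f \<rho>))
       (\<lambda>(\<phi>, f, g). Lp_norm p {0<..}
          (\<lambda>s. s powr ((d - 2) / (2 * p) + real k / 2) *\<^sub>R ideriv {0..} k g s))"
      by (rule equivalent_on_cong[OF space(2)]) (auto simp: space_D space_G)
  qed
qed

end
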